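(* Let $\mathcal{C}$ be a Krull-Schmidt category with local descending chain condition on ideals. Let $\mathfrak{I}$ be an idempotent ideal of $\mathcal{C}$, let $\mathfrak{L}$ be a representative set of identity maps contained in $\mathfrak{I}$ (one identity map $1_X$ for each isomorphism class of objects $X$ with $1_X\in\mathfrak{I}$), and let $\mathfrak{R} = \mathfrak{I}\cap \mathrm{rad}_{\mathcal{C}}^*$. Then $\mathfrak{I}$ is generated, as an ideal of $\mathcal{C}$, by $\mathfrak{L}\cup\mathfrak{R}$.
   Context: An additive category $\mathcal{C}$ is a Krull-Schmidt category if it is skeletally small, every indecomposable object has a local endomorphism ring, and every object is a finite coproduct of indecomposable objects. An ideal $\mathfrak{I}$ of a skeletally small additive category $\mathcal{C}$ is a class of morphisms containing all zero morphisms and closed under addition and under composition with arbitrary morphisms of $\mathcal{C}$ from the left and right, whenever defined; $\mathfrak{I}(X,Y) = \mathfrak{I}\cap \mathrm{Hom}_{\mathcal{C}}(X,Y)$. For a natural number $n\ge 1$, $\mathfrak{I}^n$ is the ideal generated by all compositions of $n$-tuples of morphisms from $\mathfrak{I}$. $\mathfrak{I}$ is idempotent if $\mathfrak{I}=\mathfrak{I}^2$. $\mathcal{C}$ has local descending chain condition on ideals if for any decreasing sequence $\mathfrak{I}_0 \supseteq \mathfrak{I}_1 \supseteq \mathfrak{I}_2\supseteq\dots$ of ideals of $\mathcal{C}$ and any objects $X,Y$ of $\mathcal{C}$ the chain $\mathfrak{I}_0(X,Y)\supseteq \mathfrak{I}_1(X,Y)\supseteq \mathfrak{I}_2(X,Y)\supseteq\dots$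 stabilizes. Transfinite powers of an ideal $\mathfrak{I}$: $\mathfrak{I}^0$ is the ideal of all morphisms; for finite $n \geq 1$, $\mathfrak{I}^n$ is the ideal generated by all compositions of $n$-tuples of morphisms from $\mathfrak{I}$; if $\alpha$ is a limit ordinal, $\mathfrak{I}^\alpha=\bigcap_{\beta<\alpha}\mathfrak{I}^\beta$; if $\alpha$ is infinite and non-limit, write uniquely $\alpha=\beta+n$ with $\beta$ a limit ordinal and $n\ge1$ a natural number, and set $\mathfrak{I}^\alpha=(\mathfrak{I}^\beta)^{n+1}$. Put $\mathfrak{I}^*=\bigcap_\alpha \mathfrak{I}^\alpha$. The radical $\mathrm{rad}_{\mathcal{C}}$ of a Krull-Schmidt category is the ideal generated by all non-invertible morphisms between indecomposable objects; $\mathrm{rad}_{\mathcal{C}}^*$ is called the transfinite radical of $\mathcal{C}$. *)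

theory Defs
  imports "HOL-Algebra.Ideal"
begin

section \<open>Additive categories\<close>

text \<open>\<open>f \<cdot>\<^bsub>C\<^esub> g\<close> is the composite "first \<open>g\<close>, then \<open>f\<close>"; \<open>Null C X Y\<close> is the zero morphism
  from \<open>X\<close> to \<open>Y\<close>. The operations are only constrained where they are meaningful.\<close>

record ('o, 'm) cat =
  Obj :: "'o set"
  Mor :: "'m set"
  Dom :: "'m \<Rightarrow> 'o"
  Cod :: "'m \<Rightarrow> 'o"
  Ident :: "'o \<Rightarrow> 'm"
  Comp :: "'m \<Rightarrow> 'm \<Rightarrow> 'm"  (infixr \<open>\<cdot>\<index>\<close> 70)
  Plus :: "'m \<Rightarrow> 'm \<Rightarrow> 'm"
  Null :: "'o \<Rightarrow> 'o \<Rightarrow> 'm"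

definition Hom :: "('o, 'm, 'x) cat_scheme \<Rightarrow> 'o \<Rightarrow> 'o \<Rightarrow> 'm set" where
  "Hom C X Y = {f \<in> Mor C. Dom C f = X \<and> Cod C f = Y}"

locale category =
  fixes C :: "('o, 'm, 'x) cat_scheme" (structure)
  assumes Dom_closed: "f \<in> Mor C \<Longrightarrow> Dom C f \<in> Obj C"
    and Cod_closed: "f \<in> Mor C \<Longrightarrow> Cod C f \<in> Obj C"
    and Ident_closed: "X \<in> Obj C \<Longrightarrow> Ident C X \<in> Hom C X X"
    and Comp_closed: "\<lbrakk>f \<in> Hom C X Y; g \<in> Hom C Y Z\<rbrakk> \<Longrightarrow> g \<cdot> f \<in> Hom C X Z"
    and Comp_Ident_right: "f \<in> Hom C X Y \<Longrightarrow> f \<cdot> Ident C X = f"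
    and Comp_Ident_left: "f \<in> Hom C X Y \<Longrightarrow> Ident C Y \<cdot> f = f"
    and Comp_assoc: "\<lbrakk>f \<in> Hom C W X; g \<in> Hom C X Y; h \<in> Hom C Y Z\<rbrakk>
      \<Longrightarrow> (h \<cdot> g) \<cdot> f = h \<cdot> (g \<cdot> f)"

definition hom_group :: "('o, 'm, 'x) cat_scheme \<Rightarrow> 'o \<Rightarrow> 'o \<Rightarrow> 'm monoid" where
  "hom_group C X Y = \<lparr>carrier = Hom C X Y, mult = Plus C, one = Null C X Y\<rparr>"

locale preadditive_category = category C
  for C :: "('o, 'm, 'x) cat_scheme" (structure) +
  assumes hom_comm_group: "\<lbrakk>X \<in> Obj C; Y \<in> Obj C\<rbrakk> \<Longrightarrow> comm_group (hom_group C X Y)"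
    and Comp_Plus_left: "\<lbrakk>f \<in> Hom C X Y; g \<in> Hom C Y Z; h \<in> Hom C Y Z\<rbrakk>
      \<Longrightarrow> Plus C g h \<cdot> f = Plus C (g \<cdot> f) (h \<cdot> f)"
    and Comp_Plus_right: "\<lbrakk>f \<in> Hom C X Y; g \<in> Hom C X Y; h \<in> Hom C Y Z\<rbrakk>
      \<Longrightarrow> h \<cdot> Plus C f g = Plus C (h \<cdot> f) (h \<cdot> g)"

definition is_coproduct ::
  "('o, 'm, 'x) cat_scheme \<Rightarrow> nat \<Rightarrow> (nat \<Rightarrow> 'o) \<Rightarrow> (nat \<Rightarrow> 'm) \<Rightarrow> 'o \<Rightarrow> bool" where
  "is_coproduct C n Xs \<iota> X \<longleftrightarrow>
     X \<in> Obj C \<and> (\<forall>i<n. Xs i \<in> Obj C \<and> \<iota> i \<in> Hom C (Xs i) X) \<and>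
     (\<forall>Z\<in>Obj C. \<forall>h. (\<forall>i<n. h i \<in> Hom C (Xs i) Z) \<longrightarrow>
        (\<exists>!u. u \<in> Hom C X Z \<and> (\<forall>i<n. u \<cdot>\<^bsub>C\<^esub> \<iota> i = h i)))"

text \<open>The case \<open>n = 0\<close> below provides a zero object.\<close>

locale additive_category = preadditive_category C
  for C :: "('o, 'm, 'x) cat_scheme" (structure) +
  assumes finite_coproducts:
    "(\<And>i. i < n \<Longrightarrow> Xs i \<in> Obj C) \<Longrightarrow> \<exists>X \<iota>. is_coproduct C n Xs \<iota> X"

definition is_iso :: "('o, 'm, 'x) cat_scheme \<Rightarrow> 'm \<Rightarrow> bool" where
  "is_iso C f \<longleftrightarrow> f \<in> Mor C \<and>
     (\<exists>g \<in> Hom C (Cod C f) (Dom C f).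
        g \<cdot>\<^bsub>C\<^esub> f = Ident C (Dom C f) \<and> f \<cdot>\<^bsub>C\<^esub> g = Ident C (Cod C f))"

definition isomorphic_objects :: "('o, 'm, 'x) cat_scheme \<Rightarrow> 'o \<Rightarrow> 'o \<Rightarrow> bool" where
  "isomorphic_objects C X Y \<longleftrightarrow> (\<exists>f \<in> Hom C X Y. is_iso C f)"

definition zero_object :: "('o, 'm, 'x) cat_scheme \<Rightarrow> 'o \<Rightarrow> bool" where
  "zero_object C X \<longleftrightarrow> X \<in> Obj C \<and>
     (\<forall>Y\<in>Obj C. (\<exists>!f. f \<in> Hom C X Y) \<and> (\<exists>!f. f \<in> Hom C Y X))"

definition indecomposable :: "('o, 'm, 'x) cat_scheme \<Rightarrow> 'o \<Rightarrow> bool" where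
  "indecomposable C X \<longleftrightarrow> X \<in> Obj C \<and> \<not> zero_object C X \<and>
     (\<forall>Xs \<iota>. is_coproduct C 2 Xs \<iota> X \<longrightarrow> zero_object C (Xs 0) \<or> zero_object C (Xs 1))"

definition endo_ring :: "('o, 'm, 'x) cat_scheme \<Rightarrow> 'o \<Rightarrow> 'm ring" where
  "endo_ring C X = \<lparr>carrier = Hom C X X, mult = Comp C, one = Ident C X,
     zero = Null C X X, add = Plus C\<rparr>"

text \<open>A not necessarily commutative ring is local if its non-units form a two-sided ideal. As
  an ideal is non-empty, \<open>\<zero>\<close> is a non-unit, so the trivial ring is excluded.\<close>

definition local_ring :: "('a, 'x) ring_scheme \<Rightarrow> bool" where
  "local_ring R \<longleftrightarrow> ring R \<and> ideal (carrier R - Units R) R"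

text \<open>Skeletal smallness needs no clause: objects and morphisms form sets in the sense of HOL.\<close>

locale krull_schmidt_category = additive_category C
  for C :: "('o, 'm, 'x) cat_scheme" (structure) +
  assumes local_endo_ring: "indecomposable C X \<Longrightarrow> local_ring (endo_ring C X)"
    and decomposition: "X \<in> Obj C \<Longrightarrow>
      \<exists>n Xs \<iota>. (\<forall>i<n. indecomposable C (Xs i)) \<and> is_coproduct C n Xs \<iota> X"


section \<open>Ideals and their finite powers\<close>

definition cat_ideal :: "('o, 'm, 'x) cat_scheme \<Rightarrow> 'm set \<Rightarrow> bool" where
  "cat_ideal C I \<longleftrightarrow> I \<subseteq> Mor C \<and>
     (\<forall>X\<in>Obj C. \<forall>Y\<in>Obj C. Null C X Y \<in> I) \<and>
     (\<forall>X Y. \<forall>f \<in> I \<inter> Hom C X Y. \<forall>g \<in> I \<inter> Hom C X Y. Plus C f g \<in> I) \<and>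
     (\<forall>f\<in>I. \<forall>g\<in>Mor C. Dom C g = Cod C f \<longrightarrow> g \<cdot>\<^bsub>C\<^esub> f \<in> I) \<and>
     (\<forall>f\<in>I. \<forall>g\<in>Mor C. Dom C f = Cod C g \<longrightarrow> f \<cdot>\<^bsub>C\<^esub> g \<in> I)"

definition ideal_generated :: "('o, 'm, 'x) cat_scheme \<Rightarrow> 'm set \<Rightarrow> 'm set" where
  "ideal_generated C S = \<Inter>{J. cat_ideal C J \<and> S \<subseteq> J}"

definition local_dcc_on_ideals :: "('o, 'm, 'x) cat_scheme \<Rightarrow> bool" where
  "local_dcc_on_ideals C \<longleftrightarrow>
     (\<forall>J :: nat \<Rightarrow> 'm set. (\<forall>n. cat_ideal C (J n)) \<and> (\<forall>n. J (Suc n) \<subseteq> J n) \<longrightarrow>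
        (\<forall>X\<in>Obj C. \<forall>Y\<in>Obj C. \<exists>N. \<forall>n\<ge>N. J n \<inter> Hom C X Y = J N \<inter> Hom C X Y))"

text \<open>All composites of composable \<open>n\<close>-tuples from \<open>I\<close>; the empty tuples give the identities.\<close>

primrec compositions :: "('o, 'm, 'x) cat_scheme \<Rightarrow> 'm set \<Rightarrow> nat \<Rightarrow> 'm set" where
  "compositions C I 0 = Ident C ` Obj C"
| "compositions C I (Suc n) =
     {g \<cdot>\<^bsub>C\<^esub> f |g f. g \<in> I \<and> f \<in> compositions C I n \<and> Dom C g = Cod C f}"

definition ideal_power :: "('o, 'm, 'x) cat_scheme \<Rightarrow> 'm set \<Rightarrow> nat \<Rightarrow> 'm set" where
  "ideal_power C I n = (if n = 0 then Mor C else ideal_generated C (compositions C I n))"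

definition idempotent_ideal :: "('o, 'm, 'x) cat_scheme \<Rightarrow> 'm set \<Rightarrow> bool" where
  "idempotent_ideal C I \<longleftrightarrow> cat_ideal C I \<and> I = ideal_power C I 2"


section \<open>Transfinite powers\<close>

text \<open>An element \<open>a\<close> of a well-ordered type stands for the order type of \<open>{..<a}\<close>.\<close>

definition is_limit :: "'a::wellorder \<Rightarrow> bool" where
  "is_limit a \<longleftrightarrow> (\<exists>b. b < a) \<and> (\<forall>b<a. \<exists>c. b < c \<and> c < a)"

text \<open>For an infinite ordinal \<open>\<alpha> = \<beta> + n\<close> with \<open>\<beta>\<close> a limit, \<open>limit_part \<alpha> = \<beta>\<close> and
  \<open>n = card {\<beta>..<\<alpha>}\<close>.\<close>

definition limit_part :: "'a::wellorder \<Rightarrow> 'a" where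
  "limit_part a = (THE b. is_limit b \<and> b \<le> a \<and> finite {b..<a})"

lemma limit_part_unique:
  fixes a :: "'a::wellorder"
  assumes "is_limit b" "b \<le> a" "finite {b..<a}" "is_limit c" "c \<le> a" "finite {c..<a}"
  shows "b = c"
proof -
  have aux: False
    if "is_limit y" "x < y" "y \<le> a" "finite {x..<a}" for x y :: 'a
  proof -
    have fin: "finite {x..<y}"
      by (rule finite_subset[OF _ that(4)]) (use that(3) in auto)
    have ne: "{x..<y} \<noteq> {}"
      using that by auto
    from Max_in[OF fin ne] have m: "x \<le> Max {x..<y}" "Max {x..<y} < y"
      by auto
    have "\<forall>b<y. \<exists>c. b < c \<and> c < y"
      using that(1) by (simp add: is_limit_def)
    then obtain d where "Max {x..<y} < d" "d < y"
      using m(2) by metis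
    moreover from this m have "d \<in> {x..<y}"
      by (meson atLeastLessThan_iff le_less_trans less_imp_le)
    ultimately show False
      using Max_ge[OF fin] by (meson leD)
  qed
  show ?thesis
    using aux[of b c] aux[of c b] assms by (meson linorder_cases)
qed

lemma limit_part_exists:
  fixes a :: "'a::wellorder"
  assumes "infinite {..<a}"
  shows "\<exists>b. is_limit b \<and> b \<le> a \<and> finite {b..<a}"
  using assms
proof (induction a rule: less_induct)
  case (less a)
  show ?case
  proof (cases "is_limit a")
    case True
    then show ?thesis by (intro exI[of _ a]) simp
  next
    case False
    have "{..<a} \<noteq> {}"
      using less.prems by (metis finite.emptyI)
    with False obtain b where b: "b < a" "\<And>c. b < c \<Longrightarrow> \<not> c < a"
      by (auto simp: is_limit_def)
    have less_a: "x < a \<longleftrightarrow> x = b \<or> x < b" for x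
      using b(1) b(2)[of x] by (cases x b rule: linorder_cases) auto
    have eq: "{..<a} = insert b {..<b}"
      unfolding lessThan_def by (simp only: less_a) blast
    with less.prems have "infinite {..<b}" by simp
    from less.IH[OF b(1) this] obtain c where c: "is_limit c" "c \<le> b" "finite {c..<b}" by blast
    have "{c..<a} \<subseteq> insert b {c..<b}"
      by (auto simp: less_a)
    then have "finite {c..<a}"
      using c(3) by (meson finite_insert finite_subset)
    with c b(1) show ?thesis
      by (meson le_less_trans less_imp_le)
  qed
qed

lemma limit_part:
  fixes a :: "'a::wellorder"
  assumes "infinite {..<a}"
  shows "is_limit (limit_part a)" "limit_part a \<le> a" "finite {limit_part a..<a}"
proof -
  have "\<exists>!b. is_limit b \<and> b \<le> a \<and> finite {b..<a}"
    using limit_part_exists[OF assms] limit_part_unique[of _ a] by blast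
  from theI'[OF this]
  show "is_limit (limit_part a)" "limit_part a \<le> a" "finite {limit_part a..<a}"
    by (simp_all add: limit_part_def)
qed

lemma limit_part_less:
  fixes a :: "'a::wellorder"
  assumes "infinite {..<a}" "\<not> is_limit a"
  shows "limit_part a < a"
  using limit_part[OF assms(1)] assms(2) by (metis order.not_eq_order_implies_strict)

lemma limit_part_eqI: "\<lbrakk>is_limit b; b \<le> a; finite {b..<a}\<rbrakk> \<Longrightarrow> limit_part a = b"
  unfolding limit_part_def by (rule the_equality) (auto intro: limit_part_unique)

lemma is_limit_infinite: "is_limit a \<Longrightarrow> infinite {..<a}"
proof
  assume l: "is_limit a" and fin: "finite {..<a}"
  from l have "{..<a} \<noteq> {}" by (auto simp: is_limit_def)
  from Max_in[OF fin this] have "Max {..<a} < a" by simp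
  with l obtain d where "Max {..<a} < d" "d < a" by (auto simp: is_limit_def)
  with Max_ge[OF fin, of d] show False by simp
qed

function transfinite_power ::
  "('o, 'm, 'x) cat_scheme \<Rightarrow> 'm set \<Rightarrow> 'a::wellorder \<Rightarrow> 'm set" where
  "transfinite_power C I a =
     (if finite {..<a} then ideal_power C I (card {..<a})
      else if is_limit a then (\<Inter>b\<in>{..<a}. transfinite_power C I b)
      else ideal_power C (transfinite_power C I (limit_part a)) (card {limit_part a..<a} + 1))"
  by pat_completeness auto
termination
  by (relation "{((C, I, b), (C', I', a)). b < a}")
     (auto simp: limit_part_less intro: wf_subset[OF wf_inv_image[OF wf, of "\<lambda>p. snd (snd p)"]])

declare transfinite_power.simps [simp del]

text \<open>For the intersection over all ordinals it suffices, in a category whose morphisms are of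
  type \<open>'m\<close>, to let the exponents range over the ordinals of cardinality less than
  \<open>2\<^bsup>|nat \<times> 'm|\<^esup>\<close>: decreasing families of sets of morphisms become stationary before that.
  This is the content of \<open>transfinite_power_inf_subset\<close> below.\<close>

typedef 'm ordinal = "UNIV :: (nat \<times> 'm) set set" ..

instantiation ordinal :: (type) wellorder
begin

definition less_eq_ordinal :: "'a ordinal \<Rightarrow> 'a ordinal \<Rightarrow> bool" where
  "a \<le> b \<longleftrightarrow> (Rep_ordinal a, Rep_ordinal b) \<in> card_of (UNIV :: (nat \<times> 'a) set set)"

definition less_ordinal :: "'a ordinal \<Rightarrow> 'a ordinal \<Rightarrow> bool" where
  "a < b \<longleftrightarrow> a \<le> b \<and> \<not> b \<le> (a :: 'a ordinal)"

instance
proof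
  define r where "r = card_of (UNIV :: (nat \<times> 'a) set set)"
  have r: "well_order_on UNIV r"
    unfolding r_def by (rule card_of_well_order_on)
  then have refl: "refl_on UNIV r" and trans: "trans r" and anti: "antisym r"
      and total: "total_on UNIV r" and wf: "wf (r - Id)"
    by (simp_all add: order_on_defs)
  have le: "x \<le> y \<longleftrightarrow> (Rep_ordinal x, Rep_ordinal y) \<in> r" for x y :: "'a ordinal"
    by (simp add: less_eq_ordinal_def r_def)
  fix x y z :: "'a ordinal"
  show "x < y \<longleftrightarrow> x \<le> y \<and> \<not> y \<le> x"
    by (rule less_ordinal_def)
  show "x \<le> x"
    using refl by (simp add: le refl_on_def)
  show "x \<le> z" if "x \<le> y" "y \<le> z"
    using that trans by (auto simp: le dest: transD)
  show "x = y" if "x \<le> y" "y \<le> x"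
    using that anti by (auto simp: le Rep_ordinal_inject dest: antisymD)
  show "x \<le> y \<or> y \<le> x"
    using total refl by (cases "x = y") (auto simp: le total_on_def refl_on_def Rep_ordinal_inject)
  fix P :: "'a ordinal \<Rightarrow> bool" and a :: "'a ordinal"
  assume step: "\<And>x. (\<And>y. y < x \<Longrightarrow> P y) \<Longrightarrow> P x"
  have "wf {(y, x). (Rep_ordinal y, Rep_ordinal x) \<in> r - Id}"
    using wf_inv_image[OF wf, of Rep_ordinal] by (simp add: inv_image_def)
  then show "P a"
  proof (induction a rule: wf_induct_rule)
    case (less x)
    show ?case
    proof (rule step)
      fix y assume "y < x"
      then have "(Rep_ordinal y, Rep_ordinal x) \<in> r - Id"
        using refl by (auto simp: less_ordinal_def le refl_on_def)
      then show "P y"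
        using less by simp
    qed
  qed
qed

end

definition transfinite_power_inf :: "('o, 'm, 'x) cat_scheme \<Rightarrow> 'm set \<Rightarrow> 'm set" where
  "transfinite_power_inf C I = (\<Inter>\<alpha> :: 'm ordinal. transfinite_power C I \<alpha>)"

lemma Field_wellorder: "Field {(x :: 'a::wellorder, y). x \<le> y} = UNIV"
  by (auto simp: Field_def)

lemma Well_order_wellorder: "Well_order {(x :: 'a::wellorder, y). x \<le> y}"
proof -
  have "{(x :: 'a, y). x \<le> y} - Id = {(x, y). x < y}" by auto
  then have "wf ({(x :: 'a, y). x \<le> y} - Id)"
    using wf by simp
  then show ?thesis
    unfolding order_on_defs Field_wellorder
    by (auto simp: refl_on_def trans_def antisym_def total_on_def)
qed

context preadditive_category
begin

lemma Null_closed: "\<lbrakk>X \<in> Obj C; Y \<in> Obj C\<rbrakk> \<Longrightarrow> Null C X Y \<in> Hom C X Y"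
  using hom_comm_group[of X Y] monoid.one_closed[of "hom_group C X Y"]
  by (auto simp: comm_group_def group_def hom_group_def)

lemma Plus_closed:
  assumes "f \<in> Hom C X Y" "g \<in> Hom C X Y"
  shows "Plus C f g \<in> Hom C X Y"
proof -
  have "X \<in> Obj C" "Y \<in> Obj C"
    using assms Dom_closed Cod_closed by (auto simp: Hom_def)
  then interpret comm_group "hom_group C X Y" by (rule hom_comm_group)
  show ?thesis
    using m_closed[of f g] assms by (simp add: hom_group_def)
qed

lemma Comp_Mor:
  "\<lbrakk>f \<in> Mor C; g \<in> Mor C; Dom C g = Cod C f\<rbrakk> \<Longrightarrow> g \<cdot> f \<in> Hom C (Dom C f) (Cod C g)"
  by (rule Comp_closed) (auto simp: Hom_def)

lemma Comp_Null_right: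
  assumes g: "g \<in> Hom C Y Z" and X: "X \<in> Obj C"
  shows "g \<cdot> Null C X Y = Null C X Z"
proof -
  have Y: "Y \<in> Obj C" and Z: "Z \<in> Obj C"
    using g Dom_closed Cod_closed by (auto simp: Hom_def)
  interpret XY: comm_group "hom_group C X Y" using X Y by (rule hom_comm_group)
  interpret XZ: comm_group "hom_group C X Z" using X Z by (rule hom_comm_group)
  have n: "Null C X Y \<in> Hom C X Y" using X Y by (rule Null_closed)
  have "Plus C (Null C X Y) (Null C X Y) = Null C X Y"
    using XY.l_one[OF XY.one_closed] by (simp add: hom_group_def)
  then have "g \<cdot> Null C X Y = Plus C (g \<cdot> Null C X Y) (g \<cdot> Null C X Y)"
    using Comp_Plus_right[OF n n g] by simp
  then show ?thesis
    using XZ.l_cancel_one[of "g \<cdot> Null C X Y" "g \<cdot> Null C X Y"] Comp_closed[OF n g]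
    by (simp add: hom_group_def)
qed

lemma cat_ideal_Mor: "cat_ideal C (Mor C)"
  using Null_closed Plus_closed Comp_Mor by (fastforce simp: cat_ideal_def Hom_def)

lemma cat_ideal_Inter:
  assumes "\<J> \<noteq> {}" "\<And>J. J \<in> \<J> \<Longrightarrow> cat_ideal C J"
  shows "cat_ideal C (\<Inter>\<J>)"
  unfolding cat_ideal_def
proof (intro conjI ballI allI impI)
  from assms(1) obtain J where "J \<in> \<J>" by blast
  with assms(2)[of J] show "\<Inter>\<J> \<subseteq> Mor C" by (auto simp: cat_ideal_def)
next
  fix X Y f g assume "f \<in> \<Inter>\<J> \<inter> Hom C X Y" "g \<in> \<Inter>\<J> \<inter> Hom C X Y"
  then have "f \<in> J \<inter> Hom C X Y" "g \<in> J \<inter> Hom C X Y" if "J \<in> \<J>" for J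
    using that by auto
  then show "Plus C f g \<in> \<Inter>\<J>"
    using assms(2) unfolding cat_ideal_def by blast
qed (use assms(2) in \<open>simp_all add: cat_ideal_def\<close>)

lemma ideal_generated_least: "\<lbrakk>cat_ideal C J; S \<subseteq> J\<rbrakk> \<Longrightarrow> ideal_generated C S \<subseteq> J"
  by (auto simp: ideal_generated_def)

lemma ideal_generated_superset: "S \<subseteq> ideal_generated C S"
  by (auto simp: ideal_generated_def)

lemma cat_ideal_generated: "S \<subseteq> Mor C \<Longrightarrow> cat_ideal C (ideal_generated C S)"
  unfolding ideal_generated_def using cat_ideal_Mor by (intro cat_ideal_Inter) auto

lemma cat_ideal_subset: "cat_ideal C I \<Longrightarrow> I \<subseteq> Mor C"
  by (simp add: cat_ideal_def)

lemma compositions_subset: "I \<subseteq> Mor C \<Longrightarrow> compositions C I n \<subseteq> Mor C"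
  using Ident_closed Comp_Mor by (induction n) (fastforce simp: Hom_def)+

lemma cat_ideal_power: "I \<subseteq> Mor C \<Longrightarrow> cat_ideal C (ideal_power C I n)"
  by (simp add: ideal_power_def cat_ideal_Mor cat_ideal_generated compositions_subset)

lemma ideal_power_superset: "I \<subseteq> Mor C \<Longrightarrow> compositions C I n \<subseteq> ideal_power C I n"
  using compositions_subset[of I 0] ideal_generated_superset by (auto simp: ideal_power_def)

lemma ideal_power_Suc_subset:
  assumes I: "I \<subseteq> Mor C"
  shows "ideal_power C I (Suc n) \<subseteq> ideal_power C I n"
proof -
  have "compositions C I (Suc n) \<subseteq> ideal_power C I n"
  proof
    fix x assume "x \<in> compositions C I (Suc n)"
    then obtain g f where x: "x = g \<cdot> f" "g \<in> I" "f \<in> compositions C I n" "Dom C g = Cod C f"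
      by auto
    then have "f \<in> ideal_power C I n" "g \<in> Mor C"
      using ideal_power_superset[OF I, of n] I by auto
    with x(1,4) cat_ideal_power[OF I, of n] show "x \<in> ideal_power C I n"
      by (auto simp: cat_ideal_def)
  qed
  then show ?thesis
    using cat_ideal_power[OF I, of n] ideal_generated_least
    by (simp add: ideal_power_def[of C I "Suc n"] del: compositions.simps)
qed

lemma ideal_power_antimono:
  assumes "I \<subseteq> Mor C" "m \<le> n"
  shows "ideal_power C I n \<subseteq> ideal_power C I m"
  using assms(2) ideal_power_Suc_subset[OF assms(1)]
  by (rule lift_Suc_antimono_le[of "ideal_power C I", rotated])

lemma ideal_power_1:
  assumes "cat_ideal C I"
  shows "ideal_power C I 1 = I"
proof -
  have "compositions C I 1 = I"
  proof
    show "compositions C I 1 \<subseteq> I"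
      using assms Ident_closed by (fastforce simp: cat_ideal_def Hom_def)
    show "I \<subseteq> compositions C I 1"
    proof
      fix f assume "f \<in> I"
      moreover from this assms have f: "f \<in> Hom C (Dom C f) (Cod C f)" "Dom C f \<in> Obj C"
        using Dom_closed by (auto simp: cat_ideal_def Hom_def)
      moreover have "f = f \<cdot> Ident C (Dom C f)"
        using Comp_Ident_right[OF f(1)] by simp
      moreover have "Ident C (Dom C f) \<in> Hom C (Dom C f) (Dom C f)"
        using Ident_closed[OF f(2)] .
      ultimately show "f \<in> compositions C I 1"
        by (simp add: Hom_def) (metis imageI)
    qed
  qed
  then show ?thesis
    using ideal_generated_superset[of I] ideal_generated_least[OF assms, of I]
    by (simp add: ideal_power_def del: compositions.simps One_nat_def)
qed

lemma ideal_power_Suc_le: "cat_ideal C I \<Longrightarrow> ideal_power C I (Suc n) \<subseteq> I"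
  using ideal_power_antimono[of I 1 "Suc n"] ideal_power_1 cat_ideal_subset by auto

lemma idempotent_ideal_power:
  assumes "idempotent_ideal C I"
  shows "ideal_power C I (Suc n) = I"
proof
  have I: "cat_ideal C I" "I \<subseteq> Mor C" and I2: "I = ideal_generated C (compositions C I 2)"
    using assms cat_ideal_subset by (auto simp: idempotent_ideal_def ideal_power_def)
  show "ideal_power C I (Suc n) \<subseteq> I"
    using I(1) by (rule ideal_power_Suc_le)
  show "I \<subseteq> ideal_power C I (Suc n)"
  proof (induction n)
    case 0
    then show ?case using ideal_power_1[OF I(1)] by simp
  next
    case (Suc n)
    define K where "K = ideal_power C I (Suc (Suc n))"
    have K: "cat_ideal C K"
      unfolding K_def using I(2) by (rule cat_ideal_power)
    define Q where "Q = {f \<in> Mor C. \<forall>g\<in>I. Dom C g = Cod C f \<longrightarrow> g \<cdot> f \<in> K}"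
    have "cat_ideal C Q"
      unfolding cat_ideal_def
    proof (intro conjI ballI allI impI)
      show "Q \<subseteq> Mor C" by (auto simp: Q_def)
    next
      fix X Y assume XY: "X \<in> Obj C" "Y \<in> Obj C"
      have "g \<cdot> Null C X Y \<in> K" if "g \<in> I" "Dom C g = Y" for g
        using Comp_Null_right[of g Y "Cod C g" X] that I(2) XY K Cod_closed
        by (auto simp: Hom_def cat_ideal_def subset_iff)
      then show "Null C X Y \<in> Q"
        using Null_closed[OF XY] by (auto simp: Q_def Hom_def)
    next
      fix X Y f f' assume f: "f \<in> Q \<inter> Hom C X Y" "f' \<in> Q \<inter> Hom C X Y"
      have p: "Plus C f f' \<in> Hom C X Y" using f by (intro Plus_closed) auto
      have "g \<cdot> Plus C f f' \<in> K" if g: "g \<in> I" "Dom C g = Y" for g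
      proof -
        have h: "g \<in> Hom C Y (Cod C g)" using g I(2) by (auto simp: Hom_def)
        have "g \<cdot> f \<in> K \<inter> Hom C X (Cod C g)" "g \<cdot> f' \<in> K \<inter> Hom C X (Cod C g)"
          using f g Comp_closed[OF _ h] by (auto simp: Q_def Hom_def)
        then have "Plus C (g \<cdot> f) (g \<cdot> f') \<in> K"
          using K unfolding cat_ideal_def by blast
        then show ?thesis
          using Comp_Plus_right[of f X Y f' g "Cod C g"] f h by simp
      qed
      then show "Plus C f f' \<in> Q"
        using p by (auto simp: Q_def Hom_def)
    next
      fix f h assume f: "f \<in> Q" and h: "h \<in> Mor C" "Dom C h = Cod C f"
      have f': "f \<in> Mor C" using f by (simp add: Q_def)
      have hf: "h \<cdot> f \<in> Hom C (Dom C f) (Cod C h)" using Comp_Mor[OF f' h] .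
      have "g \<cdot> (h \<cdot> f) \<in> K" if g: "g \<in> I" "Dom C g = Cod C h" for g
      proof -
        have "g \<cdot> h \<in> I" "g \<cdot> h \<in> Hom C (Dom C h) (Cod C g)"
          using I g h Comp_Mor[of h g] by (auto simp: cat_ideal_def)
        then have "(g \<cdot> h) \<cdot> f \<in> K" using f h by (auto simp: Q_def Hom_def)
        then show ?thesis
          using Comp_assoc[of f "Dom C f" "Cod C f" h "Cod C h" g "Cod C g"] f' h g I(2)
          by (auto simp: Hom_def)
      qed
      then show "h \<cdot> f \<in> Q" using hf by (auto simp: Q_def Hom_def)
    next
      fix f h assume f: "f \<in> Q" and h: "h \<in> Mor C" "Dom C f = Cod C h"
      have f': "f \<in> Mor C" using f by (simp add: Q_def)
      have fh: "f \<cdot> h \<in> Hom C (Dom C h) (Cod C f)" using Comp_Mor[OF h(1) f' h(2)] .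
      have "g \<cdot> (f \<cdot> h) \<in> K" if g: "g \<in> I" "Dom C g = Cod C f" for g
      proof -
        have "g \<cdot> f \<in> K" "g \<cdot> f \<in> Hom C (Dom C f) (Cod C g)"
          using f g I(2) f' Comp_Mor[of f g] by (auto simp: Q_def)
        then have "(g \<cdot> f) \<cdot> h \<in> K"
          using K h by (auto simp: cat_ideal_def Hom_def)
        then show ?thesis
          using Comp_assoc[of h "Dom C h" "Cod C h" f "Cod C f" g "Cod C g"] f' h g I(2)
          by (auto simp: Hom_def)
      qed
      then show "f \<cdot> h \<in> Q" using fh by (auto simp: Q_def Hom_def)
    qed
    moreover have "compositions C I (Suc n) \<subseteq> Q"
    proof
      fix f assume f: "f \<in> compositions C I (Suc n)"
      then have "g \<cdot> f \<in> compositions C I (Suc (Suc n))" if "g \<in> I" "Dom C g = Cod C f" for g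
        using that by auto
      then show "f \<in> Q"
        using f compositions_subset[OF I(2), of "Suc n"] ideal_power_superset[OF I(2), of "Suc (Suc n)"]
        unfolding Q_def K_def by blast
    qed
    ultimately have "ideal_power C I (Suc n) \<subseteq> Q"
      using ideal_generated_least by (simp add: ideal_power_def del: compositions.simps)
    with Suc.IH have IQ: "I \<subseteq> Q" by simp
    have "compositions C I 2 \<subseteq> K"
    proof
      fix x assume "x \<in> compositions C I 2"
      then obtain g y where x: "x = g \<cdot> y" "g \<in> I" "y \<in> compositions C I 1" "Dom C g = Cod C y"
        by (simp add: numeral_2_eq_2 del: compositions.simps(1)) blast
      have "y \<in> I"
        using x(3) ideal_power_superset[OF I(2), of 1] ideal_power_1[OF I(1)] by auto
      with x IQ show "x \<in> K" by (auto simp: Q_def)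
    qed
    then show ?case
      using ideal_generated_least[OF K, of "compositions C I 2"] I2 unfolding K_def by blast
  qed
qed

lemma cat_ideal_transfinite_power:
  assumes "cat_ideal C I"
  shows "cat_ideal C (transfinite_power C I a)"
proof (induction a rule: less_induct)
  case (less a)
  show ?case
  proof (cases "finite {..<a}")
    case True
    then show ?thesis
      using cat_ideal_power cat_ideal_subset[OF assms] by (subst transfinite_power.simps) simp
  next
    case inf: False
    show ?thesis
    proof (cases "is_limit a")
      case True
      have "transfinite_power C I a = \<Inter>(transfinite_power C I ` {..<a})"
        using inf True by (subst transfinite_power.simps) simp
      also have "cat_ideal C \<dots>"
        using less inf by (intro cat_ideal_Inter) auto
      finally show ?thesis .
    next
      case False
      then show ?thesis
        using less limit_part_less[OF inf False] inf cat_ideal_power cat_ideal_subset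
        by (subst transfinite_power.simps) auto
    qed
  qed
qed

lemma transfinite_power_antimono:
  fixes a b :: "'b::wellorder"
  assumes I: "cat_ideal C I" and "a \<le> b"
  shows "transfinite_power C I b \<subseteq> transfinite_power C I a"
  using \<open>a \<le> b\<close>
proof (induction b rule: less_induct)
  case (less b)
  have sub: "transfinite_power C I c \<subseteq> Mor C" for c :: 'b
    using cat_ideal_subset[OF cat_ideal_transfinite_power[OF I]] .
  show ?case
  proof (cases "a = b")
    case False
    with less have ab: "a < b" by simp
    show ?thesis
    proof (cases "finite {..<b}")
      case True
      have sub': "{..<a} \<subseteq> {..<b}" using ab by auto
      then have "finite {..<a}" "card {..<a} \<le> card {..<b}"
        using True by (auto intro: finite_subset card_mono)
      with True show ?thesis
        using ideal_power_antimono[OF cat_ideal_subset[OF I]]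
        by (simp add: transfinite_power.simps[of C I a] transfinite_power.simps[of C I b])
    next
      case inf: False
      show ?thesis
      proof (cases "is_limit b")
        case True
        with inf ab show ?thesis
          by (subst transfinite_power.simps) auto
      next
        case nl: False
        note lp = limit_part[OF inf] limit_part_less[OF inf nl]
        let ?c = "limit_part b"
        have eq: "transfinite_power C I b =
            ideal_power C (transfinite_power C I ?c) (card {?c..<b} + 1)"
          using inf nl by (subst transfinite_power.simps) simp
        show ?thesis
        proof (cases "a \<le> ?c")
          case True
          have "transfinite_power C I b \<subseteq> transfinite_power C I ?c"
            using eq ideal_power_Suc_le[OF cat_ideal_transfinite_power[OF I]] by simp
          with less.IH[OF lp(4) True] show ?thesis by simp
        next
          case False
          then have ca: "?c < a" by simp
          have fin: "finite {?c..<a}"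
            by (rule finite_subset[OF _ lp(3)]) (use ab in auto)
          have lpa: "limit_part a = ?c"
            using lp(1) ca fin by (intro limit_part_eqI) auto
          have "infinite {..<a}"
            using is_limit_infinite[OF lp(1)] ca
            by (meson finite_subset lessThan_subset_iff less_imp_le)
          moreover have "\<not> is_limit a"
            using limit_part_eqI[of a a] lpa ca by auto
          ultimately have "transfinite_power C I a =
              ideal_power C (transfinite_power C I ?c) (card {?c..<a} + 1)"
            using lpa by (subst transfinite_power.simps) simp
          moreover have "card {?c..<a} \<le> card {?c..<b}"
            using lp(3) ab by (intro card_mono) auto
          ultimately show ?thesis
            using eq ideal_power_antimono[OF sub] by simp
        qed
      qed
    qed
  qed simp
qed

lemma transfinite_power_after_limit:
  fixes a b :: "'a::wellorder"
  assumes I: "cat_ideal C I" and a: "is_limit a" and "a < b"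
  shows "transfinite_power C I b \<subseteq> ideal_power C (transfinite_power C I a) 2"
proof -
  define c where "c = (LEAST c. a < c)"
  have c: "a < c" "c \<le> b"
    unfolding c_def using \<open>a < b\<close> by (auto intro: LeastI Least_le)
  have eq: "{a..<c} = {a}"
    using c(1) not_less_Least[of _ "\<lambda>c. a < c"] unfolding c_def by (auto simp: le_less)
  have lp: "limit_part c = a"
    using a c eq by (intro limit_part_eqI) auto
  have "infinite {..<c}"
    using is_limit_infinite[OF a] c(1)
    by (meson finite_subset lessThan_subset_iff less_imp_le)
  moreover have "\<not> is_limit c"
    using limit_part_eqI[of c c] lp c by auto
  ultimately have "transfinite_power C I c = ideal_power C (transfinite_power C I a) 2"
    using lp eq by (subst transfinite_power.simps) (simp add: numeral_2_eq_2)
  then show ?thesis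
    using transfinite_power_antimono[OF I c(2)] by simp
qed

lemma transfinite_power_stable:
  fixes a b :: "'a::wellorder"
  assumes I: "cat_ideal C I" and a: "is_limit a"
    and idem: "idempotent_ideal C (transfinite_power C I a)" and "a \<le> b"
  shows "transfinite_power C I b = transfinite_power C I a"
  using \<open>a \<le> b\<close>
proof (induction b rule: less_induct)
  case (less b)
  have inf: "infinite {..<b}"
    using is_limit_infinite[OF a] less.prems by (meson finite_subset lessThan_subset_iff)
  show ?case
  proof (cases "a = b \<or> is_limit b")
    case True
    then show ?thesis
    proof
      assume b: "is_limit b"
      have "transfinite_power C I a \<subseteq> transfinite_power C I c" if "c < b" for c
        using less.IH[OF that] transfinite_power_antimono[OF I, of c a]
        by (cases "a \<le> c") auto
      then have "transfinite_power C I a \<subseteq> transfinite_power C I b"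
        using inf b by (subst (2) transfinite_power.simps) auto
      then show ?thesis
        using transfinite_power_antimono[OF I less.prems] by auto
    qed simp
  next
    case False
    then have nl: "\<not> is_limit b" by simp
    note lp = limit_part[OF inf] limit_part_less[OF inf nl]
    have "a \<le> limit_part b"
    proof (rule ccontr)
      assume "\<not> ?thesis"
      moreover from this have "finite {limit_part b..<a}" "limit_part b \<le> a"
        using less.prems by (force intro: finite_subset[OF _ lp(3)])+
      ultimately show False
        using limit_part_eqI[OF lp(1), of a] limit_part_eqI[OF a, of a] by auto
    qed
    from less.IH[OF lp(4) this] show ?thesis
      using inf nl idempotent_ideal_power[OF idem] by (subst transfinite_power.simps) simp
  qed
qed

lemma transfinite_power_stabilizes:
  assumes I: "cat_ideal C I"
  shows "\<exists>a :: 'm ordinal. is_limit a \<and> idempotent_ideal C (transfinite_power C I a)"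
proof (rule ccontr)
  assume contra: "\<not> ?thesis"
  let ?P = "transfinite_power C I :: 'm ordinal \<Rightarrow> 'm set"
  have "\<exists>f. f \<in> ?P a - ideal_power C (?P a) 2" if "is_limit a" for a
  proof -
    have "ideal_power C (?P a) 2 \<subseteq> ?P a"
      using ideal_power_Suc_le[OF cat_ideal_transfinite_power[OF I], of a 1]
      by (simp add: numeral_2_eq_2)
    moreover have "?P a \<noteq> ideal_power C (?P a) 2"
      using contra that cat_ideal_transfinite_power[OF I] by (auto simp: idempotent_ideal_def)
    ultimately show ?thesis by blast
  qed
  then obtain m where m: "\<And>a. is_limit a \<Longrightarrow> m a \<in> ?P a - ideal_power C (?P a) 2"
    by metis
  have m_inj: "a = b" if ab: "is_limit a" "is_limit b" "m a = m b" for a b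
  proof -
    have False if "is_limit a" "is_limit b" "a < b" "m a = m b" for a b
      using m[OF that(1)] m[OF that(2)] transfinite_power_after_limit[OF I that(1,3)] that(4)
      by auto
    then show ?thesis
      using ab by (metis linorder_cases)
  qed
  define h where "h = (\<lambda>a. if finite {..<a} then (2 * card {..<a}, undefined)
    else (2 * card {limit_part a..<a} + 1, m (limit_part a)))"
  have card_eq: "x = y"
    if "finite {c..<x}" "finite {c..<y}" "c \<le> x" "c \<le> y" "card {c..<x} = card {c..<y}"
    for c x y :: "'m ordinal"
  proof -
    have False if "finite {c..<y}" "c \<le> x" "x < y" "card {c..<x} = card {c..<y}"
      for x y
    proof -
      have "{c..<x} \<subset> {c..<y}" using that by auto
      from psubset_card_mono[OF that(1) this] that(4) show False by simp
    qed
    then show ?thesis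
      using that by (metis linorder_cases)
  qed
  have "inj h"
  proof
    fix x y assume "h x = h y"
    consider "finite {..<x}" "finite {..<y}" | "infinite {..<x}" "infinite {..<y}"
      | "finite {..<x} \<longleftrightarrow> infinite {..<y}" by blast
    then show "x = y"
    proof cases
      case 1
      define c :: "'m ordinal" where "c = (LEAST c. True)"
      have "c \<le> z" for z unfolding c_def by (simp add: Least_le)
      then have "{..<z} = {c..<z}" "c \<le> z" for z by auto
      with 1 \<open>h x = h y\<close> show ?thesis
        using card_eq[of c x y] by (auto simp: h_def)
    next
      case 2
      note lx = limit_part[OF 2(1)] and ly = limit_part[OF 2(2)]
      have "limit_part x = limit_part y"
        using \<open>h x = h y\<close> 2 m_inj[OF lx(1) ly(1)] by (simp add: h_def)
      with \<open>h x = h y\<close> 2 lx ly show ?thesis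
        using card_eq[of "limit_part x" x y] by (simp add: h_def)
    next
      case 3
      with \<open>h x = h y\<close> show ?thesis
        by (auto simp: h_def split: if_splits) presburger+
    qed
  qed
  then have "inj (\<lambda>S. h (Abs_ordinal S))"
    by (metis Abs_ordinal_inject UNIV_I inj_def)
  then have "surj (inv_into UNIV (\<lambda>S. h (Abs_ordinal S)))"
    by (rule inj_imp_surj_inv)
  with Cantors_theorem[of "UNIV :: (nat \<times> 'm) set"] show False
    by (auto simp: Pow_UNIV)
qed

lemma transfinite_power_embed:
  fixes f :: "'a::wellorder \<Rightarrow> 'b::wellorder"
  assumes f: "\<And>a. bij_betw f {..a} {..f a}"
  shows "(is_limit (f a) \<longleftrightarrow> is_limit a) \<and> transfinite_power C I (f a) = transfinite_power C I a"
proof -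
  have inj: "f x = f y \<longleftrightarrow> x = y" for x y
  proof -
    have "inj_on f {..max x y}" using f[of "max x y"] by (simp add: bij_betw_def)
    then show ?thesis by (auto dest: inj_onD)
  qed
  have mono: "f x \<le> f y" if "x \<le> y" for x y
    using f[of y] that by (auto simp: bij_betw_def)
  have mono_iff: "f x \<le> f y \<longleftrightarrow> x \<le> y" for x y
    using mono[of x y] mono[of y x] inj[of x y] by (metis linear order_antisym)
  then have less_iff: "f x < f y \<longleftrightarrow> x < y" for x y
    by (simp add: less_le_not_le)
  have surj: "\<exists>x. y = f x" if "y \<le> f a" for y a
    using f[of a] that by (auto simp: bij_betw_def)
  have im: "f ` {..<a} = {..<f a}" for a
  proof (intro equalityI subsetI)
    fix y assume "y \<in> {..<f a}"
    moreover from this obtain x where "y = f x"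
      using surj[of y a] by (meson atLeastLessThan_iff lessThan_iff less_imp_le)
    ultimately show "y \<in> f ` {..<a}" by (auto simp: less_iff)
  qed (auto simp: less_iff)
  have im2: "f ` {c..<a} = {f c..<f a}" for c a
  proof (intro equalityI subsetI)
    fix y assume "y \<in> {f c..<f a}"
    moreover from this obtain x where "y = f x"
      using surj[of y a] by (meson atLeastLessThan_iff lessThan_iff less_imp_le)
    ultimately show "y \<in> f ` {c..<a}" by (auto simp: less_iff mono_iff)
  qed (auto simp: less_iff mono_iff)
  have inj_on: "inj_on f A" for A
    by (auto simp: inj_on_def inj)
  have lim: "is_limit (f a) \<longleftrightarrow> is_limit a" for a
  proof -
    have "(\<exists>b. b < f a) \<longleftrightarrow> {..<f a} \<noteq> {}" by auto
    also have "\<dots> \<longleftrightarrow> (\<exists>b. b < a)" unfolding im[symmetric] by auto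
    moreover have "(\<forall>b<f a. \<exists>c. b < c \<and> c < f a) \<longleftrightarrow> (\<forall>b\<in>{..<f a}. \<exists>c\<in>{..<f a}. b < c)" by auto
    moreover have "\<dots> \<longleftrightarrow> (\<forall>b<a. \<exists>c. b < c \<and> c < a)"
      unfolding im[symmetric] by (auto simp: less_iff)
    ultimately show ?thesis by (simp add: is_limit_def)
  qed
  have "transfinite_power C I (f a) = transfinite_power C I a"
  proof (induction a rule: less_induct)
    case (less a)
    have fin: "finite {..<f a} \<longleftrightarrow> finite {..<a}" and card: "card {..<f a} = card {..<a}"
      unfolding im[symmetric] by (simp_all add: finite_image_iff card_image inj_on)
    show ?case
    proof (cases "finite {..<a}")
      case True
      then show ?thesis
        by (simp add: transfinite_power.simps[of C I a] transfinite_power.simps[of C I "f a"] fin card)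
    next
      case inf: False
      show ?thesis
      proof (cases "is_limit a")
        case True
        have "transfinite_power C I (f a) = (\<Inter>b\<in>f ` {..<a}. transfinite_power C I b)"
          using True inf unfolding im by (subst transfinite_power.simps) (simp add: fin lim)
        also have "\<dots> = (\<Inter>b\<in>{..<a}. transfinite_power C I b)"
          using less by auto
        also have "\<dots> = transfinite_power C I a"
          using True inf by (subst (2) transfinite_power.simps) simp
        finally show ?thesis .
      next
        case False
        note lp = limit_part[OF inf] limit_part_less[OF inf False]
        have "limit_part (f a) = f (limit_part a)"
          using lp by (intro limit_part_eqI) (simp_all add: lim mono_iff im2[symmetric])
        moreover have "card {f (limit_part a)..<f a} = card {limit_part a..<a}"
          unfolding im2[symmetric] by (simp add: card_image inj_on)
        ultimately show ?thesis
          using less[OF lp(4)] inf False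
          by (simp add: transfinite_power.simps[of C I a] transfinite_power.simps[of C I "f a"] fin lim)
      qed
    qed
  qed
  with lim show ?thesis by simp
qed

theorem transfinite_power_inf_subset:
  fixes b :: "'b::wellorder"
  assumes I: "cat_ideal C I"
  shows "transfinite_power_inf C I \<subseteq> transfinite_power C I b"
proof -
  define r where "r = {(x :: 'm ordinal, y). x \<le> y}"
  define s where "s = {(x :: 'b, y). x \<le> y}"
  from wellorders_totally_ordered[of r s]
  consider f where "embed r s f" | g where "embed s r g"
    unfolding r_def s_def using Well_order_wellorder[where 'a = "'m ordinal"]
      Well_order_wellorder[where 'a = 'b] by blast
  then show ?thesis
  proof cases
    case (1 f)
    then have f: "bij_betw f {..a} {..f a}" for a
      by (simp add: r_def s_def embed_def under_def Field_wellorder atMost_def)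
    obtain a :: "'m ordinal" where a: "is_limit a" "idempotent_ideal C (transfinite_power C I a)"
      using transfinite_power_stabilizes[OF I] by blast
    have fa: "is_limit (f a)" "transfinite_power C I (f a) = transfinite_power C I a"
      using transfinite_power_embed[OF f] a(1) by auto
    have "transfinite_power C I (f a) \<subseteq> transfinite_power C I b"
      using transfinite_power_antimono[OF I, of b "f a"]
        transfinite_power_stable[OF I fa(1), of b] a(2) fa(2) by (cases "b \<le> f a") auto
    with fa show ?thesis
      by (auto simp: transfinite_power_inf_def)
  next
    case (2 g)
    then have g: "bij_betw g {..a} {..g a}" for a
      by (simp add: r_def s_def embed_def under_def Field_wellorder atMost_def)
    then show ?thesis
      using transfinite_power_embed[OF g, of b I] by (force simp: transfinite_power_inf_def)
  qed
qed

end

definition radical :: "('o, 'm, 'x) cat_scheme \<Rightarrow> 'm set" where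
  "radical C = ideal_generated C
     {f \<in> Mor C. indecomposable C (Dom C f) \<and> indecomposable C (Cod C f) \<and> \<not> is_iso C f}"

lemma (in preadditive_category) cat_ideal_radical: "cat_ideal C (radical C)"
  unfolding radical_def by (rule cat_ideal_generated) auto

definition transfinite_radical :: "('o, 'm, 'x) cat_scheme \<Rightarrow> 'm set" where
  "transfinite_radical C = transfinite_power_inf C (radical C)"

definition representative_identities ::
  "('o, 'm, 'x) cat_scheme \<Rightarrow> 'm set \<Rightarrow> 'm set \<Rightarrow> bool" where
  "representative_identities C I L \<longleftrightarrow>
     L \<subseteq> {Ident C X |X. X \<in> Obj C \<and> Ident C X \<in> I} \<and>
     (\<forall>X\<in>Obj C. Ident C X \<in> I \<longrightarrow>
        (\<exists>!Y. Y \<in> Obj C \<and> Ident C Y \<in> L \<and> isomorphic_objects C X Y))"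

end

theory Submission
  imports Defs
begin

text \<open>
  Let \<open>N\<close> be the ideal generated by the identities in \<open>I\<close>; the set \<open>L\<close> already generates it,
  because an identity factors through the identity of every isomorphic object. The inclusion to
  prove is \<open>I \<subseteq> N + (I \<inter> rad\<^sup>*)\<close>. As \<open>N \<subseteq> I\<close>, the modular law reduces it to \<open>I \<subseteq> N + rad\<^sup>*\<close>, and
  this follows from \<open>I \<subseteq> N + rad\<^sup>\<alpha>\<close> for all ordinals \<open>\<alpha>\<close>, which is shown by transfinite induction.

  For \<open>\<alpha> = 1\<close>, split a morphism of \<open>I\<close> into its components between indecomposable objects. They
  lie in \<open>I\<close> again. A component that is not invertible is in the radical; if a component is
  invertible, then the identity of its domain is in \<open>I\<close>, so the component is in \<open>N\<close>
  (\<open>cat_ideal_subset_sum_radical\<close>).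

  Powers are dealt with by idempotency: if \<open>I \<subseteq> N + J\<close>, then a composite of \<open>k \<ge> 1\<close> morphisms of \<open>I\<close>
  can be multiplied out, and modulo \<open>N\<close> only the product of the \<open>J\<close>-parts survives. Hence
  \<open>I = I\<^sup>k \<subseteq> N + J\<^sup>k\<close> (\<open>idempotent_ideal_subset_sum_power\<close>).

  Intersections are where sums of ideals could misbehave, and where the chain condition enters: on a
  fixed pair of objects \<open>X\<close>, \<open>Y\<close> the intersection of a chain of ideals is attained by a member of
  the chain (\<open>local_dcc_chain_attained\<close>), so a decomposition in \<open>N + rad\<^sup>\<beta>\<close> for a suitable \<open>\<beta> < \<alpha>\<close>
  is one in \<open>N + rad\<^sup>\<alpha>\<close>. The same argument passes from all \<open>rad\<^sup>\<alpha>\<close> to \<open>rad\<^sup>*\<close>.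
\<close>

section \<open>Hom groups and ideals\<close>

context preadditive_category
begin

lemma Hom_objects: "f \<in> Hom C X Y \<Longrightarrow> X \<in> Obj C \<and> Y \<in> Obj C"
  using Dom_closed Cod_closed by (auto simp: Hom_def)

lemma Plus_assoc:
  assumes "f \<in> Hom C X Y" "g \<in> Hom C X Y" "h \<in> Hom C X Y"
  shows "Plus C (Plus C f g) h = Plus C f (Plus C g h)"
proof -
  interpret comm_group "hom_group C X Y"
    using Hom_objects[OF assms(1)] hom_comm_group by blast
  show ?thesis using m_assoc[of f g h] assms by (simp add: hom_group_def)
qed

lemma Plus_commute:
  assumes "f \<in> Hom C X Y" "g \<in> Hom C X Y"
  shows "Plus C f g = Plus C g f"
proof -
  interpret comm_group "hom_group C X Y"
    using Hom_objects[OF assms(1)] hom_comm_group by blast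
  show ?thesis using m_comm[of f g] assms by (simp add: hom_group_def)
qed

lemma Plus_Null_left:
  assumes "f \<in> Hom C X Y"
  shows "Plus C (Null C X Y) f = f"
proof -
  interpret comm_group "hom_group C X Y"
    using Hom_objects[OF assms(1)] hom_comm_group by blast
  show ?thesis using l_one[of f] assms by (simp add: hom_group_def)
qed

lemma Plus_Null_right:
  assumes "f \<in> Hom C X Y"
  shows "Plus C f (Null C X Y) = f"
  using Plus_commute[OF assms Null_closed] Plus_Null_left[OF assms] Hom_objects[OF assms] by simp

lemma Plus_inverse_exists:
  assumes "f \<in> Hom C X Y"
  shows "\<exists>g\<in>Hom C X Y. Plus C g f = Null C X Y"
proof -
  interpret comm_group "hom_group C X Y"
    using Hom_objects[OF assms(1)] hom_comm_group by blast
  show ?thesis using l_inv_ex[of f] assms by (simp add: hom_group_def)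
qed

lemma Plus_interchange:
  assumes "a \<in> Hom C X Y" "b \<in> Hom C X Y" "c \<in> Hom C X Y" "d \<in> Hom C X Y"
  shows "Plus C (Plus C a b) (Plus C c d) = Plus C (Plus C a c) (Plus C b d)"
proof -
  have "Plus C (Plus C a b) (Plus C c d) = Plus C a (Plus C (Plus C b c) d)"
    using assms by (simp add: Plus_assoc[of _ X Y] Plus_closed)
  also have "\<dots> = Plus C a (Plus C (Plus C c b) d)"
    using Plus_commute[OF assms(2,3)] by simp
  also have "\<dots> = Plus C (Plus C a c) (Plus C b d)"
    using assms by (simp add: Plus_assoc[of _ X Y] Plus_closed)
  finally show ?thesis .
qed

lemma Comp_Null_left:
  assumes f: "f \<in> Hom C X Y" and Z: "Z \<in> Obj C"
  shows "Null C Y Z \<cdot> f = Null C X Z"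
proof -
  have X: "X \<in> Obj C" and Y: "Y \<in> Obj C" using Hom_objects[OF f] by auto
  interpret XZ: comm_group "hom_group C X Z" using X Z by (rule hom_comm_group)
  have n: "Null C Y Z \<in> Hom C Y Z" using Y Z by (rule Null_closed)
  have "Null C Y Z \<cdot> f = Plus C (Null C Y Z \<cdot> f) (Null C Y Z \<cdot> f)"
    using Comp_Plus_left[OF f n n] Plus_Null_left[OF n] by simp
  then show ?thesis
    using XZ.l_cancel_one[of "Null C Y Z \<cdot> f" "Null C Y Z \<cdot> f"] Comp_closed[OF f n]
    by (simp add: hom_group_def)
qed

lemma cat_ideal_Hom: "\<lbrakk>cat_ideal C J; f \<in> J\<rbrakk> \<Longrightarrow> f \<in> Hom C (Dom C f) (Cod C f)"
  by (auto simp: cat_ideal_def Hom_def)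

lemma cat_ideal_Plus:
  "\<lbrakk>cat_ideal C J; f \<in> J; g \<in> J; f \<in> Hom C X Y; g \<in> Hom C X Y\<rbrakk> \<Longrightarrow> Plus C f g \<in> J"
  unfolding cat_ideal_def by blast

lemma cat_ideal_Null: "\<lbrakk>cat_ideal C J; X \<in> Obj C; Y \<in> Obj C\<rbrakk> \<Longrightarrow> Null C X Y \<in> J"
  by (simp add: cat_ideal_def)

lemma cat_ideal_Comp_left:
  "\<lbrakk>cat_ideal C J; f \<in> J; f \<in> Hom C X Y; g \<in> Hom C Y Z\<rbrakk> \<Longrightarrow> g \<cdot> f \<in> J"
  by (auto simp: cat_ideal_def Hom_def)

lemma cat_ideal_Comp_right:
  "\<lbrakk>cat_ideal C J; g \<in> J; f \<in> Hom C X Y; g \<in> Hom C Y Z\<rbrakk> \<Longrightarrow> g \<cdot> f \<in> J"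
  by (auto simp: cat_ideal_def Hom_def)

text \<open>Ideals are closed under subtraction, since the negative of \<open>n\<close> is its composite with the
  negative of an identity.\<close>

lemma cat_ideal_summand:
  assumes J: "cat_ideal C J" and n: "n \<in> J" "n \<in> Hom C X Y" and r: "r \<in> Hom C X Y"
    and sum: "Plus C n r \<in> J"
  shows "r \<in> J"
proof -
  have Y: "X \<in> Obj C" "Y \<in> Obj C" using Hom_objects[OF r] by auto
  obtain e where e: "e \<in> Hom C Y Y" "Plus C e (Ident C Y) = Null C Y Y"
    using Plus_inverse_exists[OF Ident_closed[OF Y(2)]] by blast
  have en: "e \<cdot> n \<in> J" "e \<cdot> n \<in> Hom C X Y"
    using cat_ideal_Comp_left[OF J n e(1)] Comp_closed[OF n(2) e(1)] by auto
  have "Plus C (e \<cdot> n) n = Plus C e (Ident C Y) \<cdot> n"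
    using Comp_Plus_left[OF n(2) e(1) Ident_closed[OF Y(2)]] Comp_Ident_left[OF n(2)] by simp
  then have "Plus C (e \<cdot> n) n = Null C X Y"
    using e(2) Comp_Null_left[OF n(2) Y(2)] by simp
  then have "Plus C (e \<cdot> n) (Plus C n r) = r"
    using Plus_assoc[OF en(2) n(2) r] Plus_Null_left[OF r] by simp
  then show ?thesis
    using cat_ideal_Plus[OF J en(1) sum en(2) Plus_closed[OF n(2) r]] by simp
qed

end

section \<open>Sums of ideals\<close>

definition ideal_sum :: "('o, 'm, 'x) cat_scheme \<Rightarrow> 'm set \<Rightarrow> 'm set \<Rightarrow> 'm set" where
  "ideal_sum C N J = {Plus C n r |n r X Y. n \<in> N \<inter> Hom C X Y \<and> r \<in> J \<inter> Hom C X Y}"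

lemma ideal_sumI:
  "\<lbrakk>n \<in> N; r \<in> J; n \<in> Hom C X Y; r \<in> Hom C X Y\<rbrakk> \<Longrightarrow> Plus C n r \<in> ideal_sum C N J"
  unfolding ideal_sum_def by blast

context preadditive_category
begin

lemma ideal_sumE:
  assumes "f \<in> ideal_sum C N J" "f \<in> Hom C X Y"
  obtains n r where "f = Plus C n r" "n \<in> N" "n \<in> Hom C X Y" "r \<in> J" "r \<in> Hom C X Y"
proof -
  obtain n r X' Y' where f: "f = Plus C n r" "n \<in> N \<inter> Hom C X' Y'" "r \<in> J \<inter> Hom C X' Y'"
    using assms(1) unfolding ideal_sum_def by blast
  then have "f \<in> Hom C X' Y'" using Plus_closed by blast
  with assms(2) have "X' = X" "Y' = Y" by (auto simp: Hom_def)
  with f that show thesis by blast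
qed

lemma ideal_sum_left:
  assumes "cat_ideal C J" "n \<in> N" "n \<in> Hom C X Y"
  shows "n \<in> ideal_sum C N J"
  using ideal_sumI[of n N "Null C X Y" J C X Y] assms Plus_Null_right[OF assms(3)]
    Hom_objects[OF assms(3)] Null_closed cat_ideal_Null by auto

lemma ideal_sum_right:
  assumes "cat_ideal C N" "r \<in> J" "r \<in> Hom C X Y"
  shows "r \<in> ideal_sum C N J"
  using ideal_sumI[of "Null C X Y" N r J C X Y] assms Plus_Null_left[OF assms(3)]
    Hom_objects[OF assms(3)] Null_closed cat_ideal_Null by auto

lemma cat_ideal_sum:
  assumes N: "cat_ideal C N" and J: "cat_ideal C J"
  shows "cat_ideal C (ideal_sum C N J)"
  unfolding cat_ideal_def
proof (intro conjI ballI allI impI)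
  show sub: "ideal_sum C N J \<subseteq> Mor C"
    using Plus_closed by (force simp: ideal_sum_def Hom_def)
  show "Null C X Y \<in> ideal_sum C N J" if "X \<in> Obj C" "Y \<in> Obj C" for X Y
    using that Null_closed cat_ideal_Null[OF N] by (blast intro: ideal_sum_left[OF J])
  show "Plus C f g \<in> ideal_sum C N J"
    if f: "f \<in> ideal_sum C N J \<inter> Hom C X Y" and g: "g \<in> ideal_sum C N J \<inter> Hom C X Y" for X Y f g
  proof -
    obtain n r where f': "f = Plus C n r" "n \<in> N" "n \<in> Hom C X Y" "r \<in> J" "r \<in> Hom C X Y"
      using f by (blast elim: ideal_sumE)
    obtain n' r' where g': "g = Plus C n' r'" "n' \<in> N" "n' \<in> Hom C X Y" "r' \<in> J" "r' \<in> Hom C X Y"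
      using g by (blast elim: ideal_sumE)
    show ?thesis
      unfolding f'(1) g'(1) Plus_interchange[OF f'(3,5) g'(3,5)]
      using f' g' cat_ideal_Plus[OF N] cat_ideal_Plus[OF J] Plus_closed
      by (intro ideal_sumI[where X = X and Y = Y]) blast+
  qed
  show "g \<cdot> f \<in> ideal_sum C N J"
    if f: "f \<in> ideal_sum C N J" and g: "g \<in> Mor C" "Dom C g = Cod C f" for f g
  proof -
    obtain n r where f': "f = Plus C n r" "n \<in> N" "n \<in> Hom C (Dom C f) (Cod C f)"
        "r \<in> J" "r \<in> Hom C (Dom C f) (Cod C f)"
      using f sub ideal_sumE[OF f, of "Dom C f" "Cod C f"] by (auto simp: Hom_def)
    have g': "g \<in> Hom C (Cod C f) (Cod C g)" using g by (simp add: Hom_def)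
    have "Plus C (g \<cdot> n) (g \<cdot> r) \<in> ideal_sum C N J"
      using f' g' cat_ideal_Comp_left[OF N] cat_ideal_Comp_left[OF J] Comp_closed
      by (intro ideal_sumI[where X = "Dom C f" and Y = "Cod C g"]) blast+
    then show ?thesis
      using Comp_Plus_right[OF f'(3,5) g'] f'(1) by simp
  qed
  show "f \<cdot> g \<in> ideal_sum C N J"
    if f: "f \<in> ideal_sum C N J" and g: "g \<in> Mor C" "Dom C f = Cod C g" for f g
  proof -
    obtain n r where f': "f = Plus C n r" "n \<in> N" "n \<in> Hom C (Dom C f) (Cod C f)"
        "r \<in> J" "r \<in> Hom C (Dom C f) (Cod C f)"
      using f sub ideal_sumE[OF f, of "Dom C f" "Cod C f"] by (auto simp: Hom_def)
    have g': "g \<in> Hom C (Dom C g) (Dom C f)" using g by (simp add: Hom_def)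
    have "Plus C (n \<cdot> g) (r \<cdot> g) \<in> ideal_sum C N J"
      using f' g' cat_ideal_Comp_right[OF N] cat_ideal_Comp_right[OF J] Comp_closed
      by (intro ideal_sumI[where X = "Dom C g" and Y = "Cod C f"]) blast+
    then show ?thesis
      using Comp_Plus_left[OF g' f'(3,5)] f'(1) by simp
  qed
qed

text \<open>Multiplying out \<open>(n + r) (n' + r') = (n (n' + r') + r n') + r r'\<close> leaves, modulo \<open>N\<close>, only
  the product of the \<open>J\<close>-parts. By induction on the number of factors the \<open>J\<close>-part of a composite
  is a single composite of morphisms of \<open>J\<close>, rather than a sum of such.\<close>

lemma compositions_subset_sum:
  assumes N: "cat_ideal C N" and J: "cat_ideal C J" and I: "I \<subseteq> ideal_sum C N J"
  shows "compositions C I k \<subseteq> ideal_sum C N (compositions C J k)"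
proof (induction k)
  case 0
  show ?case
    using Ident_closed by (auto intro!: ideal_sum_right[OF N])
next
  case (Suc k)
  have mor: "I \<subseteq> Mor C" using I cat_ideal_subset[OF cat_ideal_sum[OF N J]] by blast
  show ?case
  proof
    fix x assume "x \<in> compositions C I (Suc k)"
    then obtain g f where x: "x = g \<cdot> f" "g \<in> I" "f \<in> compositions C I k" "Dom C g = Cod C f"
      by auto
    let ?X = "Dom C f" and ?Y = "Cod C f" and ?Z = "Cod C g"
    have fH: "f \<in> Hom C ?X ?Y" using x(3) compositions_subset[OF mor, of k] by (auto simp: Hom_def)
    have gH: "g \<in> Hom C ?Y ?Z" using x(2,4) mor by (auto simp: Hom_def)
    obtain n r where g: "g = Plus C n r" "n \<in> N" "n \<in> Hom C ?Y ?Z" "r \<in> J" "r \<in> Hom C ?Y ?Z"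
      using x(2) I gH by (blast elim: ideal_sumE)
    obtain n' r' where f: "f = Plus C n' r'" "n' \<in> N" "n' \<in> Hom C ?X ?Y"
        "r' \<in> compositions C J k" "r' \<in> Hom C ?X ?Y"
      using x(3) Suc.IH fH by (blast elim: ideal_sumE)
    have H: "n \<cdot> f \<in> Hom C ?X ?Z" "r \<cdot> n' \<in> Hom C ?X ?Z" "r \<cdot> r' \<in> Hom C ?X ?Z"
      using Comp_closed fH f g by blast+
    have "n \<cdot> f \<in> N" "r \<cdot> n' \<in> N"
      using cat_ideal_Comp_right[OF N g(2) fH g(3)] cat_ideal_Comp_left[OF N f(2,3) g(5)] by auto
    then have "Plus C (n \<cdot> f) (r \<cdot> n') \<in> N" using cat_ideal_Plus[OF N _ _ H(1,2)] by blast
    moreover have "r \<cdot> r' \<in> compositions C J (Suc k)"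
    proof -
      have "Dom C r = Cod C r'" using g(5) f(5) by (simp add: Hom_def)
      then show ?thesis using g(4) f(4) by auto
    qed
    ultimately have "Plus C (Plus C (n \<cdot> f) (r \<cdot> n')) (r \<cdot> r') \<in> ideal_sum C N (compositions C J (Suc k))"
      using Plus_closed[OF H(1,2)] H(3) by (intro ideal_sumI)
    moreover have "x = Plus C (Plus C (n \<cdot> f) (r \<cdot> n')) (r \<cdot> r')"
    proof -
      have "x = Plus C (n \<cdot> f) (r \<cdot> f)" using Comp_Plus_left[OF fH g(3,5)] x(1) g(1) by simp
      also have "r \<cdot> f = Plus C (r \<cdot> n') (r \<cdot> r')" using Comp_Plus_right[OF f(3,5) g(5)] f(1) by simp
      finally show ?thesis using Plus_assoc[OF H] by simp
    qed
    ultimately show "x \<in> ideal_sum C N (compositions C J (Suc k))" by simp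
  qed
qed

lemma idempotent_ideal_subset_sum_power:
  assumes I: "idempotent_ideal C I" and N: "cat_ideal C N" and J: "cat_ideal C J"
    and sub: "I \<subseteq> ideal_sum C N J"
  shows "I \<subseteq> ideal_sum C N (ideal_power C J (Suc k))"
proof -
  let ?K = "ideal_sum C N (ideal_power C J (Suc k))"
  have mor: "J \<subseteq> Mor C" using J by (rule cat_ideal_subset)
  have "compositions C I (Suc k) \<subseteq> ?K"
    using compositions_subset_sum[OF N J sub, of "Suc k"] ideal_power_superset[OF mor, of "Suc k"]
    unfolding ideal_sum_def by blast
  then have "ideal_power C I (Suc k) \<subseteq> ?K"
    using ideal_generated_least[OF cat_ideal_sum[OF N cat_ideal_power[OF mor, of "Suc k"]]]
    by (simp add: ideal_power_def[of C I] del: compositions.simps)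
  then show ?thesis using idempotent_ideal_power[OF I] by simp
qed

section \<open>Decomposition into indecomposable objects\<close>

text \<open>A finite coproduct is a biproduct: there are projections \<open>\<pi> i\<close> such that \<open>1\<^sub>X\<close> is the sum of
  the \<open>\<iota> i \<cdot> \<pi> i\<close>. It is phrased as membership in every additively closed set \<open>Q\<close>, which is how
  such a sum is used below.\<close>

lemma coproduct_projections:
  assumes cop: "is_coproduct C n Xs \<iota> X"
  obtains \<pi> where "\<And>i. i < n \<Longrightarrow> \<pi> i \<in> Hom C X (Xs i)"
    and "\<And>Q. \<lbrakk>Null C X X \<in> Q;
        \<And>d e. \<lbrakk>d \<in> Q; e \<in> Q; d \<in> Hom C X X; e \<in> Hom C X X\<rbrakk> \<Longrightarrow> Plus C d e \<in> Q;
        \<And>i. i < n \<Longrightarrow> \<iota> i \<cdot> \<pi> i \<in> Q\<rbrakk> \<Longrightarrow> Ident C X \<in> Q"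
proof -
  have X: "X \<in> Obj C" and Xs: "\<And>i. i < n \<Longrightarrow> Xs i \<in> Obj C"
    and \<iota>: "\<And>i. i < n \<Longrightarrow> \<iota> i \<in> Hom C (Xs i) X"
    and univ: "\<And>Z h. \<lbrakk>Z \<in> Obj C; \<And>i. i < n \<Longrightarrow> h i \<in> Hom C (Xs i) Z\<rbrakk> \<Longrightarrow>
        \<exists>!u. u \<in> Hom C X Z \<and> (\<forall>i<n. u \<cdot> \<iota> i = h i)"
    using cop unfolding is_coproduct_def by blast+
  have "\<exists>p. p \<in> Hom C X (Xs i) \<and>
      (\<forall>j<n. p \<cdot> \<iota> j = (if j = i then Ident C (Xs i) else Null C (Xs j) (Xs i)))" if i: "i < n" for i
  proof -
    have "(if j = i then Ident C (Xs i) else Null C (Xs j) (Xs i)) \<in> Hom C (Xs j) (Xs i)"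
      if "j < n" for j
      using Ident_closed[OF Xs[OF i]] Null_closed[OF Xs[OF that] Xs[OF i]] by simp
    with Xs[OF i] show ?thesis by (intro ex1_implies_ex univ)
  qed
  then have "\<forall>i\<in>{..<n}. \<exists>p. p \<in> Hom C X (Xs i) \<and>
      (\<forall>j<n. p \<cdot> \<iota> j = (if j = i then Ident C (Xs i) else Null C (Xs j) (Xs i)))"
    by blast
  from bchoice[OF this]
  obtain \<pi> where \<pi>: "\<And>i. i < n \<Longrightarrow> \<pi> i \<in> Hom C X (Xs i)"
    and \<delta>: "\<And>i j. \<lbrakk>i < n; j < n\<rbrakk> \<Longrightarrow> \<pi> i \<cdot> \<iota> j = (if j = i then Ident C (Xs i) else Null C (Xs j) (Xs i))"
    by blast
  have sum_Ident: "Ident C X \<in> Q"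
    if null: "Null C X X \<in> Q"
      and plus: "\<And>d e. \<lbrakk>d \<in> Q; e \<in> Q; d \<in> Hom C X X; e \<in> Hom C X X\<rbrakk> \<Longrightarrow> Plus C d e \<in> Q"
      and comp: "\<And>i. i < n \<Longrightarrow> \<iota> i \<cdot> \<pi> i \<in> Q" for Q
  proof -
    \<comment> \<open>The partial sums of the \<open>\<iota> i \<cdot> \<pi> i\<close> are characterised by their effect on the injections.\<close>
    have "\<exists>e \<in> Q \<inter> Hom C X X. \<forall>j<n. e \<cdot> \<iota> j = (if j < m then \<iota> j else Null C (Xs j) X)"
      if "m \<le> n" for m
      using that
    proof (induction m)
      case 0
      show ?case
        using null Null_closed[OF X X] Comp_Null_left[OF \<iota> X] by auto
    next
      case (Suc m)
      then obtain e where e: "e \<in> Q" "e \<in> Hom C X X"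
          "\<And>j. j < n \<Longrightarrow> e \<cdot> \<iota> j = (if j < m then \<iota> j else Null C (Xs j) X)"
        by auto
      have m: "m < n" using Suc.prems by simp
      let ?p = "\<iota> m \<cdot> \<pi> m"
      have p: "?p \<in> Hom C X X" using Comp_closed[OF \<pi>[OF m] \<iota>[OF m]] .
      have "Plus C e ?p \<cdot> \<iota> j = (if j < Suc m then \<iota> j else Null C (Xs j) X)" if j: "j < n" for j
      proof -
        have "?p \<cdot> \<iota> j = \<iota> m \<cdot> (\<pi> m \<cdot> \<iota> j)" using Comp_assoc[OF \<iota>[OF j] \<pi>[OF m] \<iota>[OF m]] .
        also have "\<dots> = (if j = m then \<iota> j else Null C (Xs j) X)"
          using \<delta>[OF m j] Comp_Ident_right[OF \<iota>[OF m]] Comp_Null_right[OF \<iota>[OF m] Xs[OF j]] by simp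
        finally have "Plus C e ?p \<cdot> \<iota> j = Plus C (if j < m then \<iota> j else Null C (Xs j) X)
            (if j = m then \<iota> j else Null C (Xs j) X)"
          using Comp_Plus_left[OF \<iota>[OF j] e(2) p] e(3)[OF j] by simp
        then show ?thesis
          using Plus_Null_left[OF \<iota>[OF j]] Plus_Null_right[OF \<iota>[OF j]]
            Plus_Null_left[OF Null_closed[OF Xs[OF j] X]]
          by (cases j m rule: linorder_cases) auto
      qed
      moreover have "Plus C e ?p \<in> Q \<inter> Hom C X X"
        using plus[OF e(1) comp[OF m] e(2) p] Plus_closed[OF e(2) p] by simp
      ultimately show ?case by blast
    qed
    from this[of n] obtain e where e: "e \<in> Q" "e \<in> Hom C X X" "\<And>j. j < n \<Longrightarrow> e \<cdot> \<iota> j = \<iota> j"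
      by auto
    have "\<exists>!u. u \<in> Hom C X X \<and> (\<forall>i<n. u \<cdot> \<iota> i = \<iota> i)" using X \<iota> by (rule univ)
    moreover have "e \<in> Hom C X X \<and> (\<forall>i<n. e \<cdot> \<iota> i = \<iota> i)" using e(2,3) by blast
    moreover have "Ident C X \<in> Hom C X X \<and> (\<forall>i<n. Ident C X \<cdot> \<iota> i = \<iota> i)"
      using Ident_closed[OF X] Comp_Ident_left[OF \<iota>] by blast
    ultimately have "e = Ident C X" by (metis (no_types, lifting))
    with e(1) show ?thesis by simp
  qed
  show thesis
  proof (rule that[of \<pi>])
    show "\<pi> i \<in> Hom C X (Xs i)" if "i < n" for i using \<pi>[OF that] .
    show "Ident C X \<in> Q"
      if "Null C X X \<in> Q"
        and "\<And>d e. \<lbrakk>d \<in> Q; e \<in> Q; d \<in> Hom C X X; e \<in> Hom C X X\<rbrakk> \<Longrightarrow> Plus C d e \<in> Q"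
        and "\<And>i. i < n \<Longrightarrow> \<iota> i \<cdot> \<pi> i \<in> Q" for Q
      using that by (rule sum_Ident)
  qed
qed

end

context krull_schmidt_category
begin

text \<open>A matrix belongs to an ideal as soon as its entries do.\<close>

lemma cat_ideal_subset_if_indecomposable:
  assumes I: "cat_ideal C I" and K: "cat_ideal C K"
    and ind: "\<And>g X Y. \<lbrakk>indecomposable C X; indecomposable C Y; g \<in> I; g \<in> Hom C X Y\<rbrakk> \<Longrightarrow> g \<in> K"
  shows "I \<subseteq> K"
proof
  fix f assume fI: "f \<in> I"
  define X Y where "X = Dom C f" and "Y = Cod C f"
  have f: "f \<in> Hom C X Y" using cat_ideal_Hom[OF I fI] by (simp add: X_def Y_def)
  have X: "X \<in> Obj C" and Y: "Y \<in> Obj C" using Hom_objects[OF f] by auto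
  obtain n Xs \<iota> where Xs: "\<And>i. i < n \<Longrightarrow> indecomposable C (Xs i)" and copX: "is_coproduct C n Xs \<iota> X"
    using decomposition[OF X] by blast
  obtain m Ys \<kappa> where Ys: "\<And>j. j < m \<Longrightarrow> indecomposable C (Ys j)" and copY: "is_coproduct C m Ys \<kappa> Y"
    using decomposition[OF Y] by blast
  have \<iota>: "\<iota> i \<in> Hom C (Xs i) X" if "i < n" for i using copX that by (simp add: is_coproduct_def)
  have \<kappa>: "\<kappa> j \<in> Hom C (Ys j) Y" if "j < m" for j using copY that by (simp add: is_coproduct_def)
  obtain \<pi> where \<pi>: "\<And>i. i < n \<Longrightarrow> \<pi> i \<in> Hom C X (Xs i)"
    and sumX: "\<And>Q. \<lbrakk>Null C X X \<in> Q;
        \<And>d e. \<lbrakk>d \<in> Q; e \<in> Q; d \<in> Hom C X X; e \<in> Hom C X X\<rbrakk> \<Longrightarrow> Plus C d e \<in> Q;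
        \<And>i. i < n \<Longrightarrow> \<iota> i \<cdot> \<pi> i \<in> Q\<rbrakk> \<Longrightarrow> Ident C X \<in> Q"
    using coproduct_projections[OF copX] by metis
  obtain \<rho> where \<rho>: "\<And>j. j < m \<Longrightarrow> \<rho> j \<in> Hom C Y (Ys j)"
    and sumY: "\<And>Q. \<lbrakk>Null C Y Y \<in> Q;
        \<And>d e. \<lbrakk>d \<in> Q; e \<in> Q; d \<in> Hom C Y Y; e \<in> Hom C Y Y\<rbrakk> \<Longrightarrow> Plus C d e \<in> Q;
        \<And>j. j < m \<Longrightarrow> \<kappa> j \<cdot> \<rho> j \<in> Q\<rbrakk> \<Longrightarrow> Ident C Y \<in> Q"
    using coproduct_projections[OF copY] by metis
  have column: "f \<cdot> \<iota> i \<in> K" if i: "i < n" for i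
  proof -
    let ?g = "f \<cdot> \<iota> i"
    have gI: "?g \<in> I" and g: "?g \<in> Hom C (Xs i) Y"
      using cat_ideal_Comp_right[OF I fI \<iota>[OF i] f] Comp_closed[OF \<iota>[OF i] f] by auto
    have "Ident C Y \<in> {e. e \<cdot> ?g \<in> K}"
    proof (rule sumY)
      show "Null C Y Y \<in> {e. e \<cdot> ?g \<in> K}"
        using Comp_Null_left[OF g Y] cat_ideal_Null[OF K _ Y] Hom_objects[OF g] by simp
      show "Plus C d e \<in> {e. e \<cdot> ?g \<in> K}"
        if "d \<in> {e. e \<cdot> ?g \<in> K}" "e \<in> {e. e \<cdot> ?g \<in> K}" "d \<in> Hom C Y Y" "e \<in> Hom C Y Y" for d e
        using that Comp_Plus_left[OF g that(3,4)]
          cat_ideal_Plus[OF K _ _ Comp_closed[OF g that(3)] Comp_closed[OF g that(4)]] by simp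
      fix j assume j: "j < m"
      have h: "\<rho> j \<cdot> ?g \<in> Hom C (Xs i) (Ys j)" using Comp_closed[OF g \<rho>[OF j]] .
      have "\<rho> j \<cdot> ?g \<in> I" using cat_ideal_Comp_left[OF I gI g \<rho>[OF j]] .
      then have "\<rho> j \<cdot> ?g \<in> K" using ind[OF Xs[OF i] Ys[OF j] _ h] by blast
      then have "\<kappa> j \<cdot> (\<rho> j \<cdot> ?g) \<in> K" using cat_ideal_Comp_left[OF K _ h \<kappa>[OF j]] by blast
      then show "\<kappa> j \<cdot> \<rho> j \<in> {e. e \<cdot> ?g \<in> K}"
        using Comp_assoc[OF g \<rho>[OF j] \<kappa>[OF j]] by simp
    qed
    then show ?thesis using Comp_Ident_left[OF g] by simp
  qed
  have "Ident C X \<in> {e. f \<cdot> e \<in> K}"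
  proof (rule sumX)
    show "Null C X X \<in> {e. f \<cdot> e \<in> K}"
      using Comp_Null_right[OF f X] cat_ideal_Null[OF K X Y] by simp
    show "Plus C d e \<in> {e. f \<cdot> e \<in> K}"
      if "d \<in> {e. f \<cdot> e \<in> K}" "e \<in> {e. f \<cdot> e \<in> K}" "d \<in> Hom C X X" "e \<in> Hom C X X" for d e
      using that Comp_Plus_right[OF that(3,4) f]
        cat_ideal_Plus[OF K _ _ Comp_closed[OF that(3) f] Comp_closed[OF that(4) f]] by simp
    show "\<iota> i \<cdot> \<pi> i \<in> {e. f \<cdot> e \<in> K}" if i: "i < n" for i
      using cat_ideal_Comp_right[OF K column[OF i] \<pi>[OF i] Comp_closed[OF \<iota>[OF i] f]]
        Comp_assoc[OF \<pi>[OF i] \<iota>[OF i] f] by simp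
  qed
  then show "f \<in> K" using Comp_Ident_right[OF f] by simp
qed

lemma cat_ideal_subset_sum_radical:
  assumes I: "cat_ideal C I" and N: "cat_ideal C N"
    and ident: "\<And>X. \<lbrakk>X \<in> Obj C; Ident C X \<in> I\<rbrakk> \<Longrightarrow> Ident C X \<in> N"
  shows "I \<subseteq> ideal_sum C N (radical C)"
proof (rule cat_ideal_subset_if_indecomposable[OF I cat_ideal_sum[OF N cat_ideal_radical]])
  fix g X Y
  assume X: "indecomposable C X" and Y: "indecomposable C Y" and g: "g \<in> I" "g \<in> Hom C X Y"
  have XO: "X \<in> Obj C" using X by (simp add: indecomposable_def)
  show "g \<in> ideal_sum C N (radical C)"
  proof (cases "is_iso C g")
    case True
    then obtain h where h: "h \<in> Hom C Y X" "h \<cdot> g = Ident C X"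
      using g(2) by (auto simp: is_iso_def Hom_def)
    have "Ident C X \<in> I" using cat_ideal_Comp_left[OF I g h(1)] h(2) by simp
    then have "Ident C X \<in> N" using ident XO by blast
    then have "g \<cdot> Ident C X \<in> N"
      using cat_ideal_Comp_left[OF N _ Ident_closed[OF XO] g(2)] by blast
    then have "g \<in> N" using Comp_Ident_right[OF g(2)] by simp
    then show ?thesis using ideal_sum_left[OF cat_ideal_radical _ g(2)] by blast
  next
    case False
    then have "g \<in> radical C"
      unfolding radical_def using X Y g(2)
      by (intro subsetD[OF ideal_generated_superset]) (simp add: Hom_def)
    then show ?thesis using ideal_sum_right[OF N _ g(2)] by blast
  qed
qed

end

section \<open>The chain condition and transfinite induction\<close>

context preadditive_category
begin

text \<open>Otherwise dependent choice would produce a descending sequence in the chain that drops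
  infinitely often on the pair \<open>X\<close>, \<open>Y\<close>.\<close>

lemma local_dcc_chain_attained:
  assumes dcc: "local_dcc_on_ideals C" and X: "X \<in> Obj C" and Y: "Y \<in> Obj C"
    and ne: "\<J> \<noteq> {}" and ideal: "\<And>J. J \<in> \<J> \<Longrightarrow> cat_ideal C J"
    and chain: "\<And>J J'. \<lbrakk>J \<in> \<J>; J' \<in> \<J>\<rbrakk> \<Longrightarrow> J \<subseteq> J' \<or> J' \<subseteq> J"
  shows "\<exists>J\<in>\<J>. J \<inter> Hom C X Y \<subseteq> \<Inter>\<J>"
proof (rule ccontr)
  assume contra: "\<not> ?thesis"
  have step: "\<exists>J'\<in>\<J>. J' \<subseteq> J \<and> J' \<inter> Hom C X Y \<noteq> J \<inter> Hom C X Y" if J: "J \<in> \<J>" for J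
  proof -
    obtain J' f where "J' \<in> \<J>" "f \<in> J \<inter> Hom C X Y" "f \<notin> J'"
      using contra J by blast
    with chain[OF J, of J'] show ?thesis by blast
  qed
  have "\<exists>s. \<forall>n. s n \<in> \<J> \<and> s (Suc n) \<subseteq> s n \<and> s (Suc n) \<inter> Hom C X Y \<noteq> s n \<inter> Hom C X Y"
  proof (rule dependent_nat_choice)
    show "\<exists>J. J \<in> \<J>" using ne by (simp add: ex_in_conv)
    show "\<exists>J'. J' \<in> \<J> \<and> J' \<subseteq> J \<and> J' \<inter> Hom C X Y \<noteq> J \<inter> Hom C X Y" if "J \<in> \<J>" for J
      using step[OF that] by (simp add: Bex_def)
  qed
  then obtain s where s: "\<And>n. s n \<in> \<J>" "\<And>n. s (Suc n) \<subseteq> s n"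
      "\<And>n. s (Suc n) \<inter> Hom C X Y \<noteq> s n \<inter> Hom C X Y"
    by auto
  have "(\<forall>n. cat_ideal C (s n)) \<and> (\<forall>n. s (Suc n) \<subseteq> s n)" using ideal s(1,2) by simp
  with dcc X Y have "\<exists>N. \<forall>n\<ge>N. s n \<inter> Hom C X Y = s N \<inter> Hom C X Y"
    unfolding local_dcc_on_ideals_def by simp
  then obtain N where "\<forall>n\<ge>N. s n \<inter> Hom C X Y = s N \<inter> Hom C X Y" ..
  then have "s (Suc N) \<inter> Hom C X Y = s N \<inter> Hom C X Y" using le_SucI by blast
  with s(3) show False by blast
qed

text \<open>The member of the chain that attains the intersection varies with \<open>X\<close> and \<open>Y\<close>. This does no
  harm, since a decomposition in a sum of ideals concerns a single morphism.\<close>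

lemma subset_sum_Inter_chain:
  assumes dcc: "local_dcc_on_ideals C" and I: "I \<subseteq> Mor C"
    and ne: "\<J> \<noteq> {}" and ideal: "\<And>J. J \<in> \<J> \<Longrightarrow> cat_ideal C J"
    and chain: "\<And>J J'. \<lbrakk>J \<in> \<J>; J' \<in> \<J>\<rbrakk> \<Longrightarrow> J \<subseteq> J' \<or> J' \<subseteq> J"
    and sub: "\<And>J. J \<in> \<J> \<Longrightarrow> I \<subseteq> ideal_sum C N J"
  shows "I \<subseteq> ideal_sum C N (\<Inter>\<J>)"
proof
  fix f assume "f \<in> I"
  then have f: "f \<in> Hom C (Dom C f) (Cod C f)" using I by (auto simp: Hom_def)
  obtain J where J: "J \<in> \<J>" "J \<inter> Hom C (Dom C f) (Cod C f) \<subseteq> \<Inter>\<J>"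
    using local_dcc_chain_attained[OF dcc _ _ ne ideal chain] Hom_objects[OF f] by blast
  obtain n r where "f = Plus C n r" "n \<in> N" "n \<in> Hom C (Dom C f) (Cod C f)"
      "r \<in> J" "r \<in> Hom C (Dom C f) (Cod C f)"
    using ideal_sumE[OF _ f] sub[OF J(1)] \<open>f \<in> I\<close> by blast
  with J(2) show "f \<in> ideal_sum C N (\<Inter>\<J>)"
    using ideal_sumI[of n N r "\<Inter>\<J>" C "Dom C f" "Cod C f"] by auto
qed

lemma transfinite_powers_chain:
  fixes a b :: "'b::wellorder"
  assumes "cat_ideal C J"
  shows "transfinite_power C J a \<subseteq> transfinite_power C J b \<or>
    transfinite_power C J b \<subseteq> transfinite_power C J a"
  using linear[of a b] transfinite_power_antimono[OF assms, of a b]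
    transfinite_power_antimono[OF assms, of b a] by blast

lemma idempotent_ideal_subset_sum_transfinite_power:
  fixes a :: "'b::wellorder"
  assumes dcc: "local_dcc_on_ideals C" and I: "idempotent_ideal C I"
    and N: "cat_ideal C N" and J: "cat_ideal C J" and sub: "I \<subseteq> ideal_sum C N J"
  shows "I \<subseteq> ideal_sum C N (transfinite_power C J a)"
proof (induction a rule: less_induct)
  case (less a)
  have mor: "I \<subseteq> Mor C" using I cat_ideal_subset by (simp add: idempotent_ideal_def)
  show ?case
  proof (cases "finite {..<a}")
    case True
    then have eq: "transfinite_power C J a = ideal_power C J (card {..<a})"
      by (subst transfinite_power.simps) simp
    show ?thesis
    proof (cases "card {..<a}")
      case 0
      then have "transfinite_power C J a = Mor C" using eq by (simp add: ideal_power_def)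
      moreover have "f \<in> ideal_sum C N (Mor C)" if "f \<in> I" for f
        using ideal_sum_right[OF N, of f "Mor C" "Dom C f" "Cod C f"] that mor
        by (auto simp: Hom_def)
      ultimately show ?thesis by auto
    next
      case (Suc k)
      then show ?thesis using eq idempotent_ideal_subset_sum_power[OF I N J sub] by simp
    qed
  next
    case inf: False
    show ?thesis
    proof (cases "is_limit a")
      case True
      have "transfinite_power C J a = \<Inter>(transfinite_power C J ` {..<a})"
        using inf True by (subst transfinite_power.simps) simp
      moreover have "I \<subseteq> ideal_sum C N (\<Inter>(transfinite_power C J ` {..<a}))"
      proof (rule subset_sum_Inter_chain[OF dcc mor])
        show "transfinite_power C J ` {..<a} \<noteq> {}" using inf by force
        show "J1 \<subseteq> J2 \<or> J2 \<subseteq> J1"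
          if "J1 \<in> transfinite_power C J ` {..<a}" "J2 \<in> transfinite_power C J ` {..<a}" for J1 J2
          using that by (elim imageE) (simp only: transfinite_powers_chain[OF J])
      qed (use less cat_ideal_transfinite_power[OF J] in auto)
      ultimately show ?thesis by simp
    next
      case False
      have "transfinite_power C J a = ideal_power C (transfinite_power C J (limit_part a))
          (Suc (card {limit_part a..<a}))"
        using inf False by (subst transfinite_power.simps) simp
      then show ?thesis
        using idempotent_ideal_subset_sum_power[OF I N cat_ideal_transfinite_power[OF J]
            less[OF limit_part_less[OF inf False]]] by simp
    qed
  qed
qed

lemma idempotent_ideal_subset_sum_transfinite_power_inf:
  assumes dcc: "local_dcc_on_ideals C" and I: "idempotent_ideal C I"
    and N: "cat_ideal C N" and J: "cat_ideal C J" and sub: "I \<subseteq> ideal_sum C N J"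
  shows "I \<subseteq> ideal_sum C N (transfinite_power_inf C J)"
  unfolding transfinite_power_inf_def
proof (rule subset_sum_Inter_chain[OF dcc])
  show "I \<subseteq> Mor C" using I cat_ideal_subset by (simp add: idempotent_ideal_def)
  show "J1 \<subseteq> J2 \<or> J2 \<subseteq> J1"
    if "J1 \<in> range (transfinite_power C J :: 'b ordinal \<Rightarrow> _)"
      "J2 \<in> range (transfinite_power C J :: 'b ordinal \<Rightarrow> _)" for J1 J2
    using that by (elim imageE) (simp only: transfinite_powers_chain[OF J])
qed (use idempotent_ideal_subset_sum_transfinite_power[OF assms]
    cat_ideal_transfinite_power[OF J] in auto)

section \<open>Representative sets of identities\<close>

text \<open>An isomorphism \<open>f : X \<rightarrow> Y\<close> with inverse \<open>g\<close> gives \<open>1\<^sub>X = g \<cdot> 1\<^sub>Y \<cdot> f\<close>.\<close>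

lemma cat_ideal_Ident_if_isomorphic:
  assumes J: "cat_ideal C J" and Y: "Ident C Y \<in> J" and iso: "isomorphic_objects C X Y"
  shows "Ident C X \<in> J"
proof -
  obtain f where f: "f \<in> Hom C X Y" "is_iso C f" using iso by (auto simp: isomorphic_objects_def)
  then obtain g where g: "g \<in> Hom C Y X" "g \<cdot> f = Ident C X"
    by (auto simp: is_iso_def Hom_def)
  have "Ident C Y \<cdot> f \<in> J"
    using cat_ideal_Comp_right[OF J Y f(1) Ident_closed] Hom_objects[OF f(1)] by blast
  then have "f \<in> J" using Comp_Ident_left[OF f(1)] by simp
  then show ?thesis using cat_ideal_Comp_left[OF J _ f(1) g(1)] g(2) by simp
qed

lemma representative_identities_generate:
  assumes "cat_ideal C I" "representative_identities C I L" "X \<in> Obj C" "Ident C X \<in> I"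
  shows "Ident C X \<in> ideal_generated C L"
proof -
  have L: "L \<subseteq> I" using assms(2) by (auto simp: representative_identities_def)
  obtain Y where Y: "Ident C Y \<in> L" "isomorphic_objects C X Y"
    using assms(2-4) unfolding representative_identities_def by metis
  have "cat_ideal C (ideal_generated C L)"
    using L cat_ideal_subset[OF assms(1)] by (intro cat_ideal_generated) auto
  then show ?thesis
    using cat_ideal_Ident_if_isomorphic Y ideal_generated_superset[of L] by blast
qed

end

theorem corollary9:
  fixes C :: "('o, 'm) cat" and I L R :: "'m set"
  assumes "krull_schmidt_category C"
    and "local_dcc_on_ideals C"
    and "idempotent_ideal C I"
    and "representative_identities C I L"
    and "R = I \<inter> transfinite_radical C"
  shows "I = ideal_generated C (L \<union> R)"
proof -
  interpret krull_schmidt_category C by fact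
  define N where "N = ideal_generated C L"
  have I: "cat_ideal C I" using assms(3) by (simp add: idempotent_ideal_def)
  have LI: "L \<subseteq> I" using assms(4) by (auto simp: representative_identities_def)
  have N: "cat_ideal C N"
    unfolding N_def using LI cat_ideal_subset[OF I] by (intro cat_ideal_generated) auto
  have NI: "N \<subseteq> I" unfolding N_def using ideal_generated_least[OF I LI] .
  have "I \<subseteq> ideal_sum C N (radical C)"
    using representative_identities_generate[OF I assms(4)]
    by (intro cat_ideal_subset_sum_radical[OF I N]) (simp add: N_def)
  then have sum: "I \<subseteq> ideal_sum C N (transfinite_radical C)"
    unfolding transfinite_radical_def
    by (rule idempotent_ideal_subset_sum_transfinite_power_inf[OF assms(2,3) N cat_ideal_radical])
  let ?G = "ideal_generated C (L \<union> R)"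
  have RI: "L \<union> R \<subseteq> I" using LI assms(5) by auto
  have G: "cat_ideal C ?G"
    using RI cat_ideal_subset[OF I] by (intro cat_ideal_generated) auto
  have LRG: "L \<union> R \<subseteq> ?G" by (rule ideal_generated_superset)
  then have NG: "N \<subseteq> ?G" unfolding N_def by (intro ideal_generated_least[OF G]) auto
  show ?thesis
  proof
    show "?G \<subseteq> I" using ideal_generated_least[OF I RI] .
    show "I \<subseteq> ?G"
    proof
      fix f assume f: "f \<in> I"
      obtain n r where nr: "f = Plus C n r" "n \<in> N" "n \<in> Hom C (Dom C f) (Cod C f)"
          "r \<in> transfinite_radical C" "r \<in> Hom C (Dom C f) (Cod C f)"
        using ideal_sumE[OF _ cat_ideal_Hom[OF I f]] sum f by blast
      have "r \<in> I" using cat_ideal_summand[OF I _ nr(3,5)] NI nr(1,2) f by blast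
      then have "r \<in> ?G" using nr(4) assms(5) LRG by blast
      then show "f \<in> ?G" using cat_ideal_Plus[OF G _ _ nr(3,5)] NG nr(1,2) by blast
    qed
  qed
qed

end
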